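(* Let $d,m\ge 1$ be integers, $n=d+m$, let $A\in\mathbb{R}^{(d+1)\times m}$ with $\omega(A)=n$, and let $\mathcal{L}=\{(\bm{x},\widetilde{\bm{x}}A)\mid \bm{x}\in\mathbb{R}^d\}\subset\mathbb{R}^n$, where $\widetilde{\bm{x}}=(1,\bm{x})$. Then: (a) If $\omega'(A)<-1$, then $\mathcal{L}$ is of Khintchine type for convergence. (b) If $\omega'(A)>n$, then $\mathcal{L}$ is not of Khintchine type for convergence.
   Context: Vectors are row vectors; $|\cdot|$ is the supremum norm; $\|\bm{y}\|$ is the sup-norm distance of $\bm{y}$ to the nearest integer vector (also for column vectors). "Decreasing" means non-increasing. The natural logarithm is redefined so that $\log t=1$ for $t\le e$. The diophantine exponent $\omega(A)$ of a real matrix $A$ with $m$ columns is the supremum (possibly $\infty$) of all $\omega\in\mathbb{R}$ such that $\|A\bm{q}^{\mathrm T}\|<|\bm{q}|^{-\omega}$ holds for infinitely many $\bm{q}\in\mathbb{Z}^m$. When $\omega(A)<\infty$, the logarithmic diophantine exponent $\omega'(A)$ is the supremum of all $\omega'\in\mathbb{R}$ such that $\|A\bm{q}^{\mathrm T}\|<|\bm{q}|^{-\omega(A)}(\log|\bm{q}|)^{-\omega'}$ holds for infinitely many $\bm{q}\in\mathbb{Z}^m$. For $\psi:\mathbb{N}\to\mathbb{R}_{\ge0}$ let $\mathcal{S}_n(\psi)=\{\bm{y}\in\mathbb{R}^n:\|q\bm{y}\|<\psi(q)\text{ for infinitely many }q\in\mathbb{N}\}$. A submanifold $\mathcal{M}$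 of $\mathbb{R}^n$ is of Khintchine type for convergence if for every decreasing $\psi:\mathbb{N}\to\mathbb{R}_{\ge0}$ with $\sum_q\psi(q)^n<\infty$ the set $\mathcal{S}_n(\psi)\cap\mathcal{M}$ is null with respect to the induced Lebesgue measure on $\mathcal{M}$. *)

theory Defs
  imports "HOL-Analysis.Analysis"
begin

section \<open>Diophantine exponents\<close>

text \<open>The supremum norm is the library's \<^const>\<open>infnorm\<close>; the types
  \<^typ>\<open>real ^ 'n\<close> and \<^typ>\<open>int ^ 'n\<close> serve both for rows and for columns.\<close>

definition real_vec :: "int ^ 'n::finite \<Rightarrow> real ^ 'n" where
  "real_vec q = (\<chi> i. real_of_int (q $ i))"

definition dist_int :: "real ^ 'n::finite \<Rightarrow> real" where
  "dist_int y = (INF p. infnorm (y - real_vec p))"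

definition logm :: "real \<Rightarrow> real" where
  "logm t = (if t \<le> exp 1 then 1 else ln t)"

text \<open>In the next two definitions the value of the right-hand side of the inequality at
  \<open>q = 0\<close> (where \<open>0 powr s = 0\<close>) is irrelevant, since only infinitude matters. The suprema are
  taken in \<^typ>\<open>ereal\<close>; in particular the supremum of the empty set is \<open>-\<infinity>\<close>.\<close>

definition dioph_exponent :: "real ^ 'm::finite ^ 'k::finite \<Rightarrow> ereal" where
  "dioph_exponent A =
     Sup {ereal w | w. infinite {q :: int ^ 'm.
       dist_int (A *v real_vec q) < infnorm (real_vec q) powr (- w)}}"

text \<open>Only meaningful when \<^term>\<open>dioph_exponent A\<close> is finite.\<close>

definition log_dioph_exponent :: "real ^ 'm::finite ^ 'k::finite \<Rightarrow> ereal" where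
  "log_dioph_exponent A =
     Sup {ereal w' | w'. infinite {q :: int ^ 'm.
       dist_int (A *v real_vec q)
         < infnorm (real_vec q) powr (- real_of_ereal (dioph_exponent A))
           * logm (infnorm (real_vec q)) powr (- w')}}"


section \<open>Induced Lebesgue measure on a submanifold\<close>

text \<open>\<open>\<phi>\<close> is a regular \<open>C\<^sup>1\<close> parametrization, with domain \<open>U\<close>, of a relatively open piece of \<open>M\<close>.
  The values of \<open>\<phi>\<close> outside \<open>U\<close> are irrelevant.\<close>

definition local_param ::
    "(real ^ 'n::finite) set \<Rightarrow> (real ^ 'd::finite) set \<Rightarrow> (real ^ 'd \<Rightarrow> real ^ 'n) \<Rightarrow> bool" where
  "local_param M U \<phi> \<longleftrightarrow>
     open U \<and>
     (\<forall>u\<in>U. \<phi> differentiable (at u) \<and> inj ((*v) (jacobian \<phi> (at u)))) \<and>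
     continuous_on U (\<lambda>u. jacobian \<phi> (at u)) \<and>
     openin (top_of_set M) (\<phi> ` U) \<and>
     (\<exists>\<theta>. homeomorphism U (\<phi> ` U) \<phi> \<theta>)"

definition volume_element :: "(real ^ 'd::finite \<Rightarrow> real ^ 'n::finite) \<Rightarrow> real ^ 'd \<Rightarrow> real" where
  "volume_element \<phi> u = sqrt (det (transpose (jacobian \<phi> (at u)) ** jacobian \<phi> (at u)))"

text \<open>The Borel measures on \<open>M\<close> given in every local parametrization by integrating the volume
  element. On a \<open>C\<^sup>1\<close> submanifold \<open>M\<close> of dimension \<open>CARD('d)\<close> there is exactly one,
  so the definite description below is well-defined there.\<close>

definition is_induced_measure ::
    "'d::finite itself \<Rightarrow> (real ^ 'n::finite) set \<Rightarrow> (real ^ 'n) measure \<Rightarrow> bool" where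
  "is_induced_measure d M \<mu> \<longleftrightarrow>
     sets \<mu> = sets (restrict_space borel M) \<and>
     (\<forall>U (\<phi> :: real ^ 'd \<Rightarrow> real ^ 'n) E.
        local_param M U \<phi> \<longrightarrow> E \<in> sets \<mu> \<longrightarrow> E \<subseteq> \<phi> ` U \<longrightarrow>
        emeasure \<mu> E = (\<integral>\<^sup>+ u \<in> {u \<in> U. \<phi> u \<in> E}. ennreal (volume_element \<phi> u) \<partial>lborel))"

definition induced_lebesgue ::
    "'d::finite itself \<Rightarrow> (real ^ 'n::finite) set \<Rightarrow> (real ^ 'n) measure" where
  "induced_lebesgue d M = completion (THE \<mu>. is_induced_measure d M \<mu>)"


section \<open>Khintchine type for convergence\<close>

text \<open>Here \<open>\<nat>\<close> is the set of positive integers; the values of \<open>\<psi>\<close> at \<open>0\<close> play no role.\<close>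

definition simul_approx :: "(nat \<Rightarrow> real) \<Rightarrow> (real ^ 'n::finite) set" where
  "simul_approx \<psi> = {y. infinite {q :: nat. q \<ge> 1 \<and> dist_int (real q *\<^sub>R y) < \<psi> q}}"

text \<open>The first argument records the dimension \<open>CARD('d)\<close> of the submanifold \<open>M\<close>.\<close>

definition khintchine_type_convergence ::
    "'d::finite itself \<Rightarrow> (real ^ 'n::finite) set \<Rightarrow> bool" where
  "khintchine_type_convergence d M \<longleftrightarrow>
     (\<forall>\<psi> :: nat \<Rightarrow> real.
        (\<forall>q\<ge>1. 0 \<le> \<psi> q) \<longrightarrow> antimono_on {1..} \<psi> \<longrightarrow> summable (\<lambda>q. \<psi> q ^ CARD('n)) \<longrightarrow>
        simul_approx \<psi> \<inter> M \<in> null_sets (induced_lebesgue d M))"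


section \<open>The affine subspace\<close>

text \<open>\<^typ>\<open>'d option\<close> indexes the \<open>d + 1\<close> coordinates of \<open>(1, x)\<close>, with \<^const>\<open>None\<close> for the leading one.\<close>

definition tilde_vec :: "real ^ 'd::finite \<Rightarrow> real ^ ('d option)" where
  "tilde_vec x = (\<chi> i. case i of None \<Rightarrow> 1 | Some j \<Rightarrow> x $ j)"

definition append_vec :: "real ^ 'd::finite \<Rightarrow> real ^ 'm::finite \<Rightarrow> real ^ ('d + 'm)" where
  "append_vec x y = (\<chi> i. case i of Inl j \<Rightarrow> x $ j | Inr k \<Rightarrow> y $ k)"

definition affine_subspace :: "real ^ 'm::finite ^ ('d::finite option) \<Rightarrow> (real ^ ('d + 'm)) set" where
  "affine_subspace A = {append_vec x (tilde_vec x v* A) | x. True}"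

end

theory Submission
  imports Defs
begin

text \<open>
  Write \<open>n = d + m\<close>, \<open>\<Phi> x = (x, (1,x) A)\<close> and \<open>\<parallel>y\<parallel>\<close> for \<^term>\<open>dist_int y\<close>.

  The definite description behind \<^const>\<open>induced_lebesgue\<close> first has to be identified. On the
  affine subspace it is a positive multiple of the push-forward of Lebesgue measure under \<open>\<Phi>\<close>:
  uniqueness follows from the global chart \<open>\<Phi>\<close>, existence is the change of variables formula for
  the transition from any other chart. Hence "null on the subspace" means "null in the
  parameter \<open>x\<close>" (lemmas \<open>affine_subspace_null\<close>, \<open>affine_subspace_not_null\<close>).

  \<^emph>\<open>Small logarithmic exponent.\<close> The hypothesis gives \<open>\<beta> > 1\<close> with
  \<open>\<parallel>A j\<parallel> \<ge> c |j|\<^sup>-\<^sup>n (log |j|)\<^sup>\<beta>\<close> for all integer \<open>j \<noteq> 0\<close>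
  (\<open>dist_int_lower_bound\<close>). If \<open>\<parallel>q \<Phi> x\<parallel> < \<delta>\<close> with \<open>q\<close> of size \<open>2\<^sup>k\<close>, then \<open>x\<close> lies in a cube of
  side about \<open>\<delta> / 2\<^sup>k\<close> around a rational point \<open>a/q\<close> such that \<open>(q,a) A\<close> is within \<open>O(\<delta>)\<close> of an
  integer vector. The expected number of such integer vectors \<open>(q,a)\<close> is \<open>\<delta>\<^sup>m 2\<^sup>k\<^sup>(\<^sup>d\<^sup>+\<^sup>1\<^sup>)\<close>.
  This is an upper bound up to a constant as soon as the points \<open>A j\<close> with \<open>|j| < 1/\<delta>\<close> are
  separated modulo 1 by a multiple of \<open>1/2\<^sup>k\<close>: the dual large sieve \<open>large_sieve_count\<close>
  exchanges the roles of the vectors \<open>(q,a)\<close> and \<open>j\<close> in a double exponential sum. The lower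
  bound for \<open>\<parallel>A j\<parallel>\<close> provides the separation provided that
  \<open>\<delta> \<ge> (2\<^sup>k k\<^sup>\<beta>)\<^sup>-\<^sup>1\<^sup>/\<^sup>n\<close>, and \<open>\<psi>\<close> may be enlarged to satisfy this because \<open>\<Sum> k\<^sup>-\<^sup>\<beta>\<close>
  converges. The cubes then have total measure \<open>O(\<Sum> 2\<^sup>k \<delta>\<^sup>n)\<close>, which is finite by Cauchy
  condensation, and the Borel-Cantelli lemma applies.

  \<^emph>\<open>Large logarithmic exponent.\<close> Every \<open>j\<close> with \<open>\<parallel>A j\<parallel>\<close> very small puts the subspace extremely
  close to a rational hyperplane of height \<open>h = |j|\<close>. Near that hyperplane the box principle needs
  only the \<open>n - 1\<close> free coordinates of \<open>q y\<close> and \<open>O(h)\<close> values of an integer linear form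
  (\<open>hyperplane_pigeonhole\<close>), so every point of the subspace has a denominator
  \<open>q \<le> Q = h\<^sup>n (log h)\<^sup>b\<close> with \<open>\<parallel>q y\<parallel> < \<epsilon> = 1 / (h log h)\<close> (\<open>good_denominator\<close>), where
  \<open>n - 1 < b < n\<close>. Here \<open>Q \<epsilon>\<^sup>n = (log h)\<^sup>b\<^sup>-\<^sup>n\<close> tends to 0, so along a sparse sequence
  of \<open>j\<close> the step functions of height \<open>\<epsilon>\<close> on \<open>q \<le> Q\<close> combine to an admissible \<open>\<psi>\<close> for which
  every point of the subspace is approximable.
\<close>


section \<open>Change of variables over an arbitrary finite index type\<close>

text \<open>The change of variables theorems used below concern index types of class
  \<^class>\<open>wellorder\<close>. A copy of a finite type carries such an order (pulled back from an arbitrary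
  injection into the natural numbers), and permuting coordinates transports the theorems.\<close>
typedef 'a wo = "UNIV :: 'a set" morphisms un_wo mk_wo by simp

lemma mk_un_wo [simp]: "mk_wo (un_wo x) = x" "un_wo (mk_wo y) = y"
  by (simp_all add: un_wo_inverse mk_wo_inverse)

lemma bij_un_wo: "bij un_wo" and bij_mk_wo: "bij mk_wo"
  by (rule o_bij[of mk_wo]; simp add: fun_eq_iff) (rule o_bij[of un_wo]; simp add: fun_eq_iff)

instance wo :: (finite) finite
proof
  have "inj_on un_wo (UNIV :: 'a wo set)" using bij_un_wo by (rule bij_is_inj)
  then show "finite (UNIV :: 'a wo set)" by (rule inj_on_finite[of _ _ UNIV]) auto
qed

instantiation wo :: (finite) wellorder
begin

definition rank_wo :: "'a wo \<Rightarrow> nat" where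
  "rank_wo = (SOME f. inj f)"

lemma inj_rank_wo: "inj (rank_wo :: 'a wo \<Rightarrow> nat)"
  unfolding rank_wo_def
proof -
  obtain f :: "'a wo \<Rightarrow> nat" and n where "inj f"
    using finite_imp_inj_to_nat_seg[of "UNIV :: 'a wo set"] by auto
  then show "inj (SOME f. inj (f :: 'a wo \<Rightarrow> nat))" by (rule someI[of inj])
qed

definition less_eq_wo :: "'a wo \<Rightarrow> 'a wo \<Rightarrow> bool" where
  "less_eq_wo x y \<longleftrightarrow> rank_wo x \<le> rank_wo y"

definition less_wo :: "'a wo \<Rightarrow> 'a wo \<Rightarrow> bool" where
  "less_wo x y \<longleftrightarrow> rank_wo x < rank_wo y"

instance
proof
  fix P :: "'a wo \<Rightarrow> bool" and a :: "'a wo"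
  assume step: "\<And>x. (\<And>y. y < x \<Longrightarrow> P y) \<Longrightarrow> P x"
  show "P a"
  proof (induction "rank_wo a" arbitrary: a rule: less_induct)
    case less
    show ?case by (rule step, rule less) (simp add: less_wo_def)
  qed
next
  fix x y :: "'a wo" assume "x \<le> y" "y \<le> x"
  then show "x = y" using injD[OF inj_rank_wo] by (simp add: less_eq_wo_def)
qed (auto simp: less_eq_wo_def less_wo_def)

end

definition relabel :: "real ^ 'd::finite \<Rightarrow> real ^ 'd wo" where
  "relabel x = (\<chi> i. x $ un_wo i)"

definition unlabel :: "real ^ 'd::finite wo \<Rightarrow> real ^ 'd" where
  "unlabel x = (\<chi> i. x $ mk_wo i)"

lemma relabel_unlabel [simp]: "relabel (unlabel x) = x" "unlabel (relabel y) = y"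
  by (simp_all add: relabel_def unlabel_def vec_eq_iff)

lemma linear_relabel: "linear relabel" and linear_unlabel: "linear unlabel"
  by (auto intro!: linearI simp: relabel_def unlabel_def vec_eq_iff)

lemma swapidseq_relabel:
  "swapidseq n p \<Longrightarrow> swapidseq n (\<lambda>i :: 'a wo. mk_wo (p (un_wo i)))"
proof (induction rule: swapidseq.induct)
  case id
  have "(\<lambda>i :: 'a wo. mk_wo (id (un_wo i))) = id" by auto
  then show ?case using swapidseq.id by simp
next
  case (comp_Suc n p a b)
  have "(\<lambda>i. mk_wo ((Transposition.transpose a b \<circ> p) (un_wo i))) = Transposition.transpose (mk_wo a) (mk_wo b) \<circ> (\<lambda>i. mk_wo (p (un_wo i)))"
    by (auto simp: fun_eq_iff Transposition.transpose_def mk_wo_inject)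
  moreover have "mk_wo a \<noteq> mk_wo b" using comp_Suc.hyps by (simp add: mk_wo_inject)
  ultimately show ?case using swapidseq.comp_Suc[OF comp_Suc.IH] by simp
qed

lemma sign_relabel:
  fixes p :: "'a::finite \<Rightarrow> 'a"
  assumes "p permutes UNIV"
  shows "sign (\<lambda>i. mk_wo (p (un_wo i))) = sign p"
proof -
  have "permutation p"
    unfolding permutation_permutes by (rule exI[of _ UNIV]) (simp add: assms)
  then obtain n where n: "swapidseq n p" unfolding permutation_def by auto
  then have "evenperm p = even n" by (rule evenperm_unique) simp
  moreover have "evenperm (\<lambda>i. mk_wo (p (un_wo i))) = even n" 
    by (rule evenperm_unique[OF swapidseq_relabel[OF n]]) simp
  ultimately show ?thesis by (simp add: sign_def)
qed

lemma bij_comp': "bij f \<Longrightarrow> bij g \<Longrightarrow> bij h \<Longrightarrow> bij (\<lambda>x. f (g (h x)))"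
  using bij_comp[of "g \<circ> h" f] bij_comp[of h g] by (simp add: o_def)

text \<open>Conjugating permutations by the bijection between the two index types matches the Leibniz
  expansions; signs agree because transpositions are conjugated to transpositions.\<close>
lemma det_relabel:
  fixes B :: "real ^ 'd::finite ^ 'd"
  shows "det (\<chi> i j. B $ un_wo i $ un_wo j :: real ^ 'd wo ^ 'd wo) = det B"
proof -
  have "(\<Sum>p\<in>{p. p permutes (UNIV :: 'd set)}. of_int (sign p) * (\<Prod>i\<in>UNIV. B $ i $ p i))
    = (\<Sum>p\<in>{p. p permutes (UNIV :: 'd wo set)}. of_int (sign p) * (\<Prod>i\<in>UNIV. B $ un_wo i $ un_wo (p i)))"
  proof (rule sum.reindex_bij_witness[where i = "\<lambda>p i. un_wo (p (mk_wo i))" and j = "\<lambda>p i. mk_wo (p (un_wo i))"])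
    fix p :: "'d \<Rightarrow> 'd" assume "p \<in> {p. p permutes UNIV}"
    then have p: "p permutes UNIV" by simp
    then show "(\<lambda>i. mk_wo (p (un_wo i))) \<in> {p. p permutes UNIV}"
      using bij_imp_permutes[OF bij_comp'[OF bij_mk_wo permutes_bij[OF p] bij_un_wo]] by simp
    have "(\<Prod>i\<in>UNIV. B $ un_wo i $ p (un_wo i)) = (\<Prod>i\<in>UNIV. B $ i $ p i)"
      by (rule prod.reindex_bij_betw[OF bij_un_wo])
    then show "of_int (sign (\<lambda>i. mk_wo (p (un_wo i)))) * (\<Prod>i\<in>UNIV. B $ un_wo i $ un_wo (mk_wo (p (un_wo i)))) =
       of_int (sign p) * (\<Prod>i\<in>UNIV. B $ i $ p i)" by (simp add: sign_relabel[OF p])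
  next
    fix p :: "'d wo \<Rightarrow> 'd wo" assume "p \<in> {p. p permutes UNIV}"
    then have p: "p permutes UNIV" by simp
    then show "(\<lambda>i. un_wo (p (mk_wo i))) \<in> {p. p permutes UNIV}"
      using bij_imp_permutes[OF bij_comp'[OF bij_un_wo permutes_bij[OF p] bij_mk_wo]] by simp
  qed auto
  then show ?thesis unfolding det_def vec_lambda_beta by (rule sym)
qed

lemma unlabel_measurable: "unlabel \<in> borel_measurable borel"
  by (rule borel_measurable_continuous_onI, rule linear_continuous_on)
    (use linear_unlabel linear_conv_bounded_linear in blast)

lemma lborel_unlabel: "distr lborel borel unlabel = (lborel :: (real ^ 'd::finite) measure)"
proof (rule lborel_eqI[symmetric])
  fix l u :: "real ^ 'd" assume lu: "\<And>b. b \<in> Basis \<Longrightarrow> l \<bullet> b \<le> u \<bullet> b"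
  have "unlabel -` box l u = box (relabel l) (relabel u)"
  proof (rule set_eqI)
    fix x :: "real ^ 'd wo"
    have "(\<forall>i. l $ i < x $ mk_wo i \<and> x $ mk_wo i < u $ i) \<longleftrightarrow> (\<forall>i. l $ un_wo i < x $ i \<and> x $ i < u $ un_wo i)"
      using mk_un_wo by metis
    then show "x \<in> unlabel -` box l u \<longleftrightarrow> x \<in> box (relabel l) (relabel u)"
      by (simp add: mem_box_cart relabel_def unlabel_def)
  qed
  moreover have "(\<Prod>b\<in>Basis. (relabel u - relabel l) \<bullet> b) = (\<Prod>b\<in>Basis. (u - l) \<bullet> b)"
  proof -
    have *: "(\<Prod>b\<in>Basis. z \<bullet> b) = (\<Prod>i\<in>UNIV. z $ i)" for z :: "real ^ 'z::finite"
    proof -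
      have B: "(Basis :: (real ^ 'z) set) = (\<lambda>i. axis i 1) ` UNIV" by (auto simp: Basis_vec_def)
      have i: "inj (\<lambda>i :: 'z. axis i (1::real))" by (rule injI) (simp add: axis_eq_axis)
      show ?thesis unfolding B prod.reindex[OF i] by (simp add: inner_axis)
    qed
    have "(\<Prod>i\<in>UNIV. (u - l) $ un_wo i) = (\<Prod>i\<in>UNIV. (u - l) $ i)"
      by (rule prod.reindex_bij_betw[OF bij_un_wo])
    then show ?thesis unfolding * by (simp add: relabel_def)
  qed
  moreover have "relabel l \<bullet> b \<le> relabel u \<bullet> b" if "b \<in> Basis" for b
  proof -
    obtain i where b: "b = axis i 1" using \<open>b \<in> Basis\<close> by (auto simp: Basis_vec_def)
    have "l \<bullet> axis (un_wo i) 1 \<le> u \<bullet> axis (un_wo i) 1" by (rule lu) (auto simp: Basis_vec_def)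
    then show ?thesis unfolding b inner_axis by (simp add: relabel_def)
  qed
  ultimately have "emeasure lborel (unlabel -` box l u) = ennreal (\<Prod>b\<in>Basis. (u - l) \<bullet> b)"
    using emeasure_lborel_box[of "relabel l" "relabel u"] by metis
  moreover have "emeasure (distr lborel borel unlabel) (box l u) = emeasure lborel (unlabel -` box l u \<inter> space lborel)"
    by (rule emeasure_distr) (use unlabel_measurable in simp_all)
  ultimately show "emeasure (distr lborel borel unlabel) (box l u) = ennreal (\<Prod>b\<in>Basis. (u - l) \<bullet> b)"
    unfolding space_lborel space_borel Int_UNIV_right by (rule trans[rotated])
qed simp

text \<open>The image has finite measure \<open>r\<close> exactly if the Jacobian has integral \<open>r\<close>
  (\<open>has_measure_differentiable_image\<close>). So if either side of the formula is finite, the other side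
  is finite and equal to it, and otherwise both are infinite.\<close>
lemma nn_integral_jacobian_wo:
  fixes g :: "real ^ 'd::{finite,wellorder} \<Rightarrow> real ^ 'd::_"
  assumes S: "S \<in> sets borel" and gS: "g ` S \<in> sets borel"
    and der: "\<And>x. x \<in> S \<Longrightarrow> (g has_derivative g' x) (at x within S)"
    and inj: "inj_on g S"
    and meas: "(\<lambda>x. \<bar>det (matrix (g' x))\<bar> * indicator S x) \<in> borel_measurable borel"
  shows "emeasure lborel (g ` S) = (\<integral>\<^sup>+ x\<in>S. ennreal \<bar>det (matrix (g' x))\<bar> \<partial>lborel)"
proof -
  let ?f = "\<lambda>x. \<bar>det (matrix (g' x))\<bar>"
  have SL: "S \<in> sets lebesgue" using S by simp
  have eqf: "(\<lambda>x. if x \<in> S then ?f x else 0) = (\<lambda>x. ?f x * indicator S x)" by (auto simp: fun_eq_iff)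
  have eqn: "(\<integral>\<^sup>+ x\<in>S. ennreal (?f x) \<partial>lborel) = (\<integral>\<^sup>+ x. ennreal (?f x * indicator S x) \<partial>lborel)"
    by (intro nn_integral_cong) (auto simp: indicator_def)
  have iff: "(?f has_integral r) S \<longleftrightarrow> (\<integral>\<^sup>+ x. ennreal (?f x * indicator S x) \<partial>lborel) = ennreal r" if "r \<ge> 0" for r
  proof -
    have "(?f has_integral r) S \<longleftrightarrow> ((\<lambda>x. ?f x * indicator S x) has_integral r) UNIV"
      unfolding has_integral_restrict_UNIV[of S, symmetric] eqf ..
    also have "\<dots> \<longleftrightarrow> (\<integral>\<^sup>+ x. ennreal (?f x * indicator S x) \<partial>lborel) = ennreal r"
    proof
      assume "((\<lambda>x. ?f x * indicator S x) has_integral r) UNIV"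
      then show "(\<integral>\<^sup>+ x. ennreal (?f x * indicator S x) \<partial>lborel) = ennreal r"
        by (rule nn_integral_has_integral_lborel[rotated 2]) (use meas in auto)
    next
      assume "(\<integral>\<^sup>+ x. ennreal (?f x * indicator S x) \<partial>lborel) = ennreal r"
      then show "((\<lambda>x. ?f x * indicator S x) has_integral r) UNIV"
        by (intro nn_integral_has_integral) (use meas that in auto)
    qed
    finally show ?thesis .
  qed
  have img: "emeasure lborel (g ` S) = ennreal r \<longleftrightarrow> g ` S \<in> lmeasurable \<and> measure lebesgue (g ` S) = r" if "r \<ge> 0" for r
  proof -
    have "emeasure lebesgue (g ` S) = emeasure lborel (g ` S)" using gS by simp
    moreover have "g ` S \<in> lmeasurable \<longleftrightarrow> emeasure lborel (g ` S) < \<infinity>"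
      unfolding fmeasurable_def using gS by simp
    moreover have "measure lebesgue (g ` S) = enn2real (emeasure lborel (g ` S))"
      unfolding measure_def using gS by simp
    ultimately show ?thesis using that by (cases "emeasure lborel (g ` S)") auto
  qed
  show ?thesis
  proof (cases "emeasure lborel (g ` S)")
    case (real r)
    then show ?thesis using img[of r] iff[of r] has_measure_differentiable_image[OF SL der inj, of r] eqn by auto
  next
    case top
    show ?thesis
    proof (cases "(\<integral>\<^sup>+ x. ennreal (?f x * indicator S x) \<partial>lborel)")
      case (real r)
      then show ?thesis using img[of r] iff[of r] has_measure_differentiable_image[OF SL der inj, of r] eqn by auto
    qed (use top eqn in auto)
  qed
qed

lemma nn_integral_jacobian:
  fixes g :: "real ^ 'd::finite \<Rightarrow> real ^ 'd"
  assumes S: "S \<in> sets borel" and gS: "g ` S \<in> sets borel"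
    and der: "\<And>x. x \<in> S \<Longrightarrow> (g has_derivative g' x) (at x within S)"
    and inj: "inj_on g S"
    and meas: "(\<lambda>x. \<bar>det (matrix (g' x))\<bar> * indicator S x) \<in> borel_measurable borel"
  shows "emeasure lborel (g ` S) = (\<integral>\<^sup>+ x\<in>S. ennreal \<bar>det (matrix (g' x))\<bar> \<partial>lborel)"
proof -
  define S1 where "S1 = unlabel -` S"
  define h where "h = relabel \<circ> g \<circ> unlabel"
  define h' where "h' x = relabel \<circ> g' (unlabel x) \<circ> unlabel" for x
  have un_img: "relabel ` X = unlabel -` X" for X :: "(real ^ 'd) set"
    by (auto simp: image_iff) (metis relabel_unlabel(1))
  have meas_vimage: "unlabel -` X \<in> sets borel" if "X \<in> sets borel" for X :: "(real ^ 'd) set"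
    using measurable_sets[OF unlabel_measurable that] by simp
  have S1: "unlabel ` S1 = S" unfolding S1_def by (auto simp: image_iff) (metis relabel_unlabel(2))
  have hS1: "h ` S1 = unlabel -` (g ` S)"
    unfolding h_def image_comp[symmetric] S1 un_img ..
  have det: "det (matrix (h' x)) = det (matrix (g' (unlabel x)))" for x
  proof -
    have "matrix (h' x) = (\<chi> i j. matrix (g' (unlabel x)) $ un_wo i $ un_wo j)"
    proof -
      have "unlabel (axis j 1) = axis (un_wo j) (1::real)" for j :: "'d wo"
        by (auto simp: unlabel_def axis_def vec_eq_iff)
      then show ?thesis by (simp only: matrix_def h'_def o_def) (simp add: relabel_def vec_eq_iff[of "vec_lambda _"])
    qed
    then show ?thesis by (simp add: det_relabel)
  qed
  have em: "emeasure lborel X = emeasure lborel (unlabel -` X)" if "X \<in> sets borel" for X :: "(real ^ 'd) set"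
    by (subst lborel_unlabel[symmetric]) (use that in \<open>simp add: emeasure_distr unlabel_measurable\<close>)
  have "emeasure lborel (g ` S) = emeasure lborel (h ` S1)"
    unfolding hS1 by (rule em[OF gS])
  also have "\<dots> = (\<integral>\<^sup>+ x\<in>S1. ennreal \<bar>det (matrix (h' x))\<bar> \<partial>lborel)"
  proof (rule nn_integral_jacobian_wo)
    show "S1 \<in> sets borel" unfolding S1_def by (rule meas_vimage[OF S])
    show "h ` S1 \<in> sets borel" unfolding hS1 by (rule meas_vimage[OF gS])
    show "inj_on h S1"
      by (rule inj_onI) (use inj in \<open>auto simp: h_def S1_def inj_on_def; metis relabel_unlabel\<close>)
    show "(h has_derivative h' x) (at x within S1)" if "x \<in> S1" for x
    proof -
      have "(g has_derivative g' (unlabel x)) (at (unlabel x) within S)" using that by (intro der) (auto simp: S1_def)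
      then have "(g has_derivative g' (unlabel x)) (at (unlabel x) within unlabel ` S1)" unfolding S1 .
      then have "((g \<circ> unlabel) has_derivative (g' (unlabel x) \<circ> unlabel)) (at x within S1)"
        by (rule diff_chain_within[OF linear_imp_has_derivative[OF linear_unlabel]])
      then show ?thesis unfolding h_def h'_def comp_assoc
        by (rule diff_chain_within[OF _ linear_imp_has_derivative[OF linear_relabel]])
    qed
    have "(\<lambda>x. \<bar>det (matrix (h' x))\<bar> * indicator S1 x) = (\<lambda>x. \<bar>det (matrix (g' x))\<bar> * indicator S x) \<circ> unlabel"
      by (auto simp: fun_eq_iff det S1_def indicator_def)
    then show "(\<lambda>x. \<bar>det (matrix (h' x))\<bar> * indicator S1 x) \<in> borel_measurable borel"
      using measurable_comp[OF unlabel_measurable meas] by simp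
  qed
  also have "\<dots> = (\<integral>\<^sup>+ x. ennreal (\<bar>det (matrix (g' (unlabel x)))\<bar> * indicator S (unlabel x)) \<partial>lborel)"
    by (intro nn_integral_cong) (auto simp: det S1_def indicator_def)
  also have "\<dots> = (\<integral>\<^sup>+ x. ennreal (\<bar>det (matrix (g' x))\<bar> * indicator S x) \<partial>distr lborel borel unlabel)"
    by (subst nn_integral_distr) (use meas in \<open>auto simp: unlabel_measurable\<close>)
  also have "\<dots> = (\<integral>\<^sup>+ x\<in>S. ennreal \<bar>det (matrix (g' x))\<bar> \<partial>lborel)"
    unfolding lborel_unlabel by (intro nn_integral_cong) (auto simp: indicator_def)
  finally show ?thesis .
qed


section \<open>The induced measure of an affine subspace\<close>

text \<open>The matrices \<open>(1 - t) I + t B\<^sup>T B\<close> are positive definite for \<open>t\<close> between 0 and 1, so their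
  determinant has no zero along the path from \<open>I\<close> to \<open>B\<^sup>T B\<close> and keeps its sign.\<close>
lemma gram_det_pos:
  fixes B :: "real ^ 'd::finite ^ 'n::finite"
  assumes inj: "\<And>x. B *v x = 0 \<Longrightarrow> x = 0"
  shows "det (transpose B ** B) > 0"
proof -
  define S where "S t = (1 - t) *\<^sub>R (mat 1 :: real ^ 'd ^ 'd) + t *\<^sub>R (transpose B ** B)" for t :: real
  have nz: "det (S t) \<noteq> 0" if t: "0 \<le> t" "t \<le> 1" for t
  proof -
    have "x = 0" if x: "S t *v x = 0" for x
    proof -
      have "0 = x \<bullet> (S t *v x)" using x by simp
      also have "S t *v x = (1 - t) *\<^sub>R x + t *\<^sub>R (transpose B *v (B *v x))"
        unfolding S_def by (simp add: matrix_vector_mult_add_rdistrib scaleR_matrix_vector_assoc[symmetric] matrix_vector_mul_assoc)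
      also have "x \<bullet> \<dots> = (1 - t) * (x \<bullet> x) + t * ((B *v x) \<bullet> (B *v x))"
        by (simp add: inner_add_right inner_commute[of x "_ v* _"] dot_lmul_matrix)
      finally have e: "(1 - t) * (x \<bullet> x) + t * ((B *v x) \<bullet> (B *v x)) = 0" by simp
      moreover have "(1 - t) * (x \<bullet> x) \<ge> 0" "t * ((B *v x) \<bullet> (B *v x)) \<ge> 0" using t by auto
      ultimately have "(1 - t) * (x \<bullet> x) = 0" "t * ((B *v x) \<bullet> (B *v x)) = 0" by linarith+
      then show "x = 0" using inj[of x] by (cases "t = 1") auto
    qed
    then have "invertible (S t)"
      using matrix_left_invertible_ker[of "S t"] invertible_left_inverse[of "S t"] by auto
    then show ?thesis by (simp add: invertible_det_nz)
  qed
  have cont: "continuous_on {0..1} (\<lambda>t. det (S t))"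
    unfolding det_def S_def by (intro continuous_intros)
  have "det (S 1) > 0"
  proof (rule ccontr)
    assume "\<not> det (S 1) > 0"
    then have "\<exists>t\<ge>0. t \<le> 1 \<and> det (S t) = 0"
      by (intro IVT2' cont) (auto simp: S_def)
    then show False using nz by auto
  qed
  then show ?thesis by (simp add: S_def)
qed

text \<open>An injective affine parametrization \<open>x \<mapsto> c + L x\<close> of an affine subspace \<open>M\<close>; \<open>P\<close> is a linear
  left inverse of \<open>L\<close> and \<open>\<pi>\<close> the resulting left inverse of the parametrization. The factor \<open>\<gamma>\<close> is
  the constant volume element of the parametrization.\<close>
locale affine_param =
  fixes L :: "real ^ 'd::finite \<Rightarrow> real ^ 'n::finite" and c :: "real ^ 'n"
  assumes linear_L: "linear L" and inj_L: "inj L"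
begin

definition \<Phi> where "\<Phi> x = c + L x"

definition P where "P = (SOME P. linear P \<and> P \<circ> L = id)"

lemma linear_P: "linear P" and PL [simp]: "P (L x) = x"
proof -
  have "\<exists>P. linear P \<and> P \<circ> L = id" using linear_L inj_L by (rule linear_injective_left_inverse)
  then have "linear P \<and> P \<circ> L = id" unfolding P_def by (rule someI_ex)
  then show "linear P" "P (L x) = x" by (auto simp: fun_eq_iff)
qed

definition M where "M = range \<Phi>"

definition \<pi> where "\<pi> y = P (y - c)"

lemma \<pi>_\<Phi> [simp]: "\<pi> (\<Phi> x) = x" by (simp add: \<pi>_def \<Phi>_def)

lemma \<Phi>_\<pi>: "y \<in> M \<Longrightarrow> \<Phi> (\<pi> y) = y" by (auto simp: M_def)

lemma cont_\<Phi>: "continuous_on X \<Phi>" and cont_\<pi>: "continuous_on Y \<pi>"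
proof -
  have *: "continuous_on X L" "continuous_on Y P" for X Y
    using linear_L linear_P linear_continuous_on linear_conv_bounded_linear by blast+
  show "continuous_on X \<Phi>" unfolding \<Phi>_def by (intro continuous_intros *)
  show "continuous_on Y \<pi>" unfolding \<pi>_def
    by (rule continuous_on_compose2[OF *(2)[of UNIV]]) (auto intro!: continuous_intros)
qed

lemma closed_M: "closed M"
proof -
  have "M = {y. \<Phi> (\<pi> y) = y}" using \<Phi>_\<pi> unfolding M_def by (auto intro: range_eqI[OF sym])
  moreover have "continuous_on UNIV (\<lambda>y. \<Phi> (\<pi> y))"
    by (rule continuous_on_compose2[OF cont_\<Phi>[of UNIV] cont_\<pi>]) auto
  ultimately show ?thesis by (simp add: closed_Collect_eq continuous_on_id)
qed

lemma borel_M: "M \<in> sets borel" using closed_M by simp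

definition \<gamma> where "\<gamma> = sqrt (det (transpose (matrix L) ** matrix L))"

lemma \<gamma>_pos: "\<gamma> > 0"
proof -
  have "x = 0" if "matrix L *v x = 0" for x
  proof -
    have "L x = L 0" using that linear_L by (simp add: matrix_works linear_0)
    then show ?thesis using inj_L by (simp add: inj_eq)
  qed
  then show ?thesis unfolding \<gamma>_def using gram_det_pos[of "matrix L"] by simp
qed

definition \<mu> where "\<mu> = scale_measure (ennreal \<gamma>) (distr lborel (restrict_space borel M) \<Phi>)"

lemma sets_\<mu>: "sets \<mu> = sets (restrict_space borel M)" by (simp add: \<mu>_def)

lemma space_\<mu>: "space \<mu> = M" by (simp add: \<mu>_def space_scale_measure space_restrict_space)

lemma \<Phi>_meas: "\<Phi> \<in> measurable borel (restrict_space borel M)"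
  by (rule measurable_restrict_space2) (auto simp: M_def intro!: borel_measurable_continuous_onI cont_\<Phi>)

lemma emeasure_\<mu>: "E \<in> sets \<mu> \<Longrightarrow> emeasure \<mu> E = ennreal \<gamma> * emeasure lborel (\<Phi> -` E)"
  unfolding sets_\<mu> unfolding \<mu>_def using \<Phi>_meas by (simp add: emeasure_distr)

text \<open>A map \<open>\<phi>\<close> into \<open>M\<close> equals \<open>\<Phi> \<circ> (\<pi> \<circ> \<phi>)\<close>, so by the chain rule its Jacobian factors through
  the square Jacobian \<open>G\<close> of the transition map, and the Gram determinant is multiplicative:
  \<open>det ((L G)\<^sup>T (L G)) = det (L\<^sup>T L) (det G)\<^sup>2\<close>.\<close>
lemma derivative_in_chart:
  fixes \<phi> :: "real ^ 'd \<Rightarrow> real ^ 'n"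
  assumes U: "open U" "u \<in> U" and sub: "\<phi> ` U \<subseteq> M" and diff: "\<phi> differentiable (at u)"
  defines "G \<equiv> P \<circ> frechet_derivative \<phi> (at u)"
  shows "((\<lambda>v. \<pi> (\<phi> v)) has_derivative G) (at u)"
    and "jacobian \<phi> (at u) = matrix L ** matrix G"
    and "volume_element \<phi> u = \<gamma> * \<bar>det (matrix G)\<bar>"
proof -
  have d: "(\<phi> has_derivative frechet_derivative \<phi> (at u)) (at u)"
    using diff frechet_derivative_works by blast
  have bP: "bounded_linear P" using linear_P linear_conv_bounded_linear by blast
  have bL: "bounded_linear L" using linear_L linear_conv_bounded_linear by blast
  show g: "((\<lambda>v. \<pi> (\<phi> v)) has_derivative G) (at u)"
    unfolding \<pi>_def G_def o_def
    by (rule bounded_linear.has_derivative[OF bP]) (auto intro!: derivative_eq_intros d)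
  then have "((\<lambda>v. \<Phi> (\<pi> (\<phi> v))) has_derivative (\<lambda>h. L (G h))) (at u)"
    unfolding \<Phi>_def by (auto intro!: derivative_eq_intros bounded_linear.has_derivative[OF bL])
  then have "(\<phi> has_derivative (\<lambda>h. L (G h))) (at u)"
    by (rule has_derivative_transform_within_open[OF _ U]) (use sub \<Phi>_\<pi> in auto)
  then have "frechet_derivative \<phi> (at u) = (\<lambda>h. L (G h))" using frechet_derivative_at by metis
  then have "jacobian \<phi> (at u) = matrix (L \<circ> G)" by (simp add: jacobian_def o_def)
  also have "\<dots> = matrix L ** matrix G"
    using has_derivative_linear[OF g] linear_L by (intro matrix_compose)
  finally show J: "jacobian \<phi> (at u) = matrix L ** matrix G" .
  have "transpose (matrix L ** matrix G) ** (matrix L ** matrix G)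
     = transpose (matrix G) ** (transpose (matrix L) ** matrix L) ** matrix G"
    by (simp add: matrix_transpose_mul matrix_mul_assoc)
  then have "volume_element \<phi> u = sqrt (det (transpose (matrix L) ** matrix L) * (det (matrix G))\<^sup>2)"
    unfolding volume_element_def J by (simp add: det_mul det_transpose power2_eq_square mult_ac)
  then show "volume_element \<phi> u = \<gamma> * \<bar>det (matrix G)\<bar>" by (simp add: real_sqrt_mult \<gamma>_def)
qed

text \<open>Existence of the induced measure: in any chart the defining formula for \<open>\<mu>\<close> is the change of
  variables formula for the transition map \<open>\<pi> \<circ> \<phi>\<close>.\<close>
lemma \<mu>_chart:
  fixes \<phi> :: "real ^ 'd \<Rightarrow> real ^ 'n"
  assumes lp: "local_param M U \<phi>" and E: "E \<in> sets \<mu>" "E \<subseteq> \<phi> ` U"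
  shows "emeasure \<mu> E = (\<integral>\<^sup>+ u \<in> {u \<in> U. \<phi> u \<in> E}. ennreal (volume_element \<phi> u) \<partial>lborel)"
proof -
  from lp have U: "open U" and diff: "\<And>u. u \<in> U \<Longrightarrow> \<phi> differentiable (at u)"
    and contJ: "continuous_on U (\<lambda>u. jacobian \<phi> (at u))" and op: "openin (top_of_set M) (\<phi> ` U)"
    and hom: "\<exists>\<theta>. homeomorphism U (\<phi> ` U) \<phi> \<theta>"
    unfolding local_param_def by auto
  have sub: "\<phi> ` U \<subseteq> M" using openin_imp_subset[OF op] .
  have inj: "inj_on \<phi> U"
    using hom by (auto intro: inj_on_inverseI dest: homeomorphism_apply1)
  have contphi: "continuous_on U \<phi>" using hom homeomorphism_def by blast
  define S where "S = {u \<in> U. \<phi> u \<in> E}"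
  define g where "g v = \<pi> (\<phi> v)" for v
  define g' where "g' u = P \<circ> frechet_derivative \<phi> (at u)" for u
  have SU: "S \<subseteq> U" by (auto simp: S_def)
  have Eb: "E \<in> sets borel" using E(1) borel_M by (auto simp: sets_\<mu> sets_restrict_space_iff)
  have EM: "E \<subseteq> M" using E sub by auto
  have Sb: "S \<in> sets borel"
  proof -
    have "\<phi> \<in> borel_measurable (restrict_space borel U)" using contphi by (rule borel_measurable_continuous_on_restrict)
    then have "\<phi> -` E \<inter> space (restrict_space borel U) \<in> sets (restrict_space borel U)" using Eb by (rule measurable_sets)
    moreover have "\<phi> -` E \<inter> space (restrict_space borel U) = S" by (auto simp: S_def space_restrict_space)
    ultimately show ?thesis using U by (auto simp: sets_restrict_space_iff)
  qed
  have gS: "g ` S = \<Phi> -` E"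
  proof (intro equalityI subsetI)
    fix x assume "x \<in> \<Phi> -` E"
    then obtain u where u: "u \<in> U" "\<phi> u = \<Phi> x" using E(2) by auto
    then show "x \<in> g ` S" using \<open>x \<in> \<Phi> -` E\<close> by (intro image_eqI[of _ _ u]) (auto simp: g_def S_def)
  next
    fix x assume "x \<in> g ` S"
    then show "x \<in> \<Phi> -` E" using EM \<Phi>_\<pi> by (auto simp: g_def S_def)
  qed
  have gSb: "g ` S \<in> sets borel"
    using measurable_sets[OF borel_measurable_continuous_onI[OF cont_\<Phi>[of UNIV]] Eb] unfolding gS by simp
  have meas: "(\<lambda>u. \<bar>det (matrix (g' u))\<bar> * indicator S u) \<in> borel_measurable borel"
  proof -
    have mg: "matrix (g' u) = matrix P ** jacobian \<phi> (at u)" if "u \<in> U" for u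
      unfolding g'_def jacobian_def
      using diff[OF that] linear_P by (intro matrix_compose linear_frechet_derivative)
    have "continuous_on S (\<lambda>u. \<bar>det (matrix P ** jacobian \<phi> (at u))\<bar>)"
      unfolding det_def matrix_matrix_mult_def
      by (simp, intro continuous_intros continuous_on_subset[OF contJ SU])
    then have "(\<lambda>u. indicator S u *\<^sub>R \<bar>det (matrix P ** jacobian \<phi> (at u))\<bar>) \<in> borel_measurable borel"
      by (rule borel_measurable_continuous_on_indicator[OF Sb])
    moreover have "(\<lambda>u. indicator S u *\<^sub>R \<bar>det (matrix P ** jacobian \<phi> (at u))\<bar>) = (\<lambda>u. \<bar>det (matrix (g' u))\<bar> * indicator S u)"
      using mg SU by (auto simp: fun_eq_iff indicator_def)
    ultimately show ?thesis by simp
  qed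
  have "emeasure lborel (g ` S) = (\<integral>\<^sup>+ x\<in>S. ennreal \<bar>det (matrix (g' x))\<bar> \<partial>lborel)"
  proof (rule nn_integral_jacobian[OF Sb gSb])
    fix u assume "u \<in> S"
    then show "(g has_derivative g' u) (at u within S)"
      unfolding g_def g'_def using derivative_in_chart(1)[OF U _ sub diff] SU has_derivative_at_withinI by blast
  next
    show "inj_on g S"
    proof (rule inj_onI)
      fix u v assume uv: "u \<in> S" "v \<in> S" "g u = g v"
      moreover have "\<Phi> (g u) = \<phi> u" "\<Phi> (g v) = \<phi> v"
        using \<Phi>_\<pi> sub SU uv(1,2) unfolding g_def by auto
      ultimately have "\<phi> u = \<phi> v" by simp
      then show "u = v" using inj uv SU by (auto simp: inj_on_def)
    qed
  qed (rule meas)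
  then have "emeasure \<mu> E = ennreal \<gamma> * (\<integral>\<^sup>+ x\<in>S. ennreal \<bar>det (matrix (g' x))\<bar> \<partial>lborel)"
    by (simp add: emeasure_\<mu>[OF E(1)] gS)
  also have "\<dots> = (\<integral>\<^sup>+ x. ennreal \<gamma> * (ennreal \<bar>det (matrix (g' x))\<bar> * indicator S x) \<partial>lborel)"
  proof (rule nn_integral_cmult[symmetric])
    show "(\<lambda>x. ennreal \<bar>det (matrix (g' x))\<bar> * indicator S x) \<in> borel_measurable lborel"
    proof (rule measurable_cong[THEN iffD1])
      show "(\<lambda>x. ennreal (\<bar>det (matrix (g' x))\<bar> * indicator S x)) \<in> borel_measurable lborel"
        using meas by simp
    qed (simp add: indicator_def)
  qed
  also have "\<dots> = (\<integral>\<^sup>+ u \<in> S. ennreal (volume_element \<phi> u) \<partial>lborel)"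
    using derivative_in_chart(3)[OF U _ sub diff] SU \<gamma>_pos
    by (intro nn_integral_cong) (auto simp: g'_def indicator_def ennreal_mult)
  finally show ?thesis by (simp add: S_def)
qed

lemma global_chart: "local_param M UNIV \<Phi>"
proof -
  have der: "(\<Phi> has_derivative L) (at u)" for u
    unfolding \<Phi>_def using linear_L by (auto intro!: derivative_eq_intros linear_imp_has_derivative)
  then have fd: "frechet_derivative \<Phi> (at u) = L" for u using frechet_derivative_at by metis
  have "homeomorphism UNIV M \<Phi> \<pi>"
    by (rule homeomorphismI) (use cont_\<Phi> cont_\<pi> \<Phi>_\<pi> in \<open>auto simp: M_def\<close>)
  moreover have "inj ((*v) (matrix L))"
    using inj_L linear_L by (simp add: inj_def matrix_works)
  ultimately show ?thesis
    unfolding local_param_def using der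
    by (auto simp: jacobian_def fd M_def[symmetric] differentiable_def)
qed

text \<open>Uniqueness needs only one chart, since \<open>\<Phi>\<close> parametrizes all of \<open>M\<close>.\<close>
lemma induced_lebesgue_eq: "induced_lebesgue TYPE('d) M = completion \<mu>"
proof -
  have "(THE \<nu>. is_induced_measure TYPE('d) M \<nu>) = \<mu>"
  proof (rule the_equality)
    show "is_induced_measure TYPE('d) M \<mu>"
      unfolding is_induced_measure_def using sets_\<mu> \<mu>_chart by blast
    fix \<nu> assume \<nu>: "is_induced_measure TYPE('d) M \<nu>"
    show "\<nu> = \<mu>"
    proof (rule measure_eqI)
      show s: "sets \<nu> = sets \<mu>" using \<nu> by (simp add: is_induced_measure_def sets_\<mu>)
      fix E assume E: "E \<in> sets \<nu>"
      have "E \<subseteq> \<Phi> ` UNIV" using sets.sets_into_space[of E \<mu>] E by (simp add: s space_\<mu> M_def)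
      then have "emeasure \<nu> E = (\<integral>\<^sup>+ u \<in> {u \<in> UNIV. \<Phi> u \<in> E}. ennreal (volume_element \<Phi> u) \<partial>lborel)"
        using \<nu> global_chart E unfolding is_induced_measure_def by blast
      moreover have "emeasure \<mu> E = (\<integral>\<^sup>+ u \<in> {u \<in> UNIV. \<Phi> u \<in> E}. ennreal (volume_element \<Phi> u) \<partial>lborel)"
        using \<open>E \<subseteq> \<Phi> ` UNIV\<close> E s by (intro \<mu>_chart global_chart) auto
      ultimately show "emeasure \<nu> E = emeasure \<mu> E" by simp
    qed
  qed
  then show ?thesis by (simp add: induced_lebesgue_def)
qed

lemma null_set_via_chart:
  assumes Z: "Z \<in> null_sets lborel" and N: "N \<subseteq> M" "\<And>x. \<Phi> x \<in> N \<Longrightarrow> x \<in> Z"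
  shows "N \<in> null_sets (induced_lebesgue TYPE('d) M)"
proof -
  have Zb: "Z \<in> sets borel" using Z by auto
  have e: "\<Phi> ` Z = \<pi> -` Z \<inter> M" using \<Phi>_\<pi> by (force simp: M_def image_iff)
  have "\<pi> -` Z \<in> sets borel"
    using measurable_sets[OF borel_measurable_continuous_onI[OF cont_\<pi>[of UNIV]] Zb] by simp
  then have s: "\<Phi> ` Z \<in> sets \<mu>" unfolding sets_\<mu> e using borel_M by (auto simp: sets_restrict_space_iff)
  have "inj \<Phi>" by (metis \<pi>_\<Phi> injI)
  then have "emeasure \<mu> (\<Phi> ` Z) = 0" using Z by (simp add: emeasure_\<mu>[OF s] inj_vimage_image_eq null_setsD1)
  then have "\<Phi> ` Z \<in> null_sets \<mu>" using s by auto
  moreover have "N \<subseteq> \<Phi> ` Z" using N by (auto simp: M_def)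
  ultimately show ?thesis unfolding induced_lebesgue_eq using null_sets_completion_subset null_sets_completionI by blast
qed

lemma not_null: "M \<notin> null_sets (induced_lebesgue TYPE('d) M)"
proof
  have s: "M \<in> sets \<mu>" using sets.top[of \<mu>] by (simp add: space_\<mu>)
  assume "M \<in> null_sets (induced_lebesgue TYPE('d) M)"
  then have "emeasure \<mu> M = 0" unfolding induced_lebesgue_eq using s by (simp add: null_sets_completion_iff null_setsD1)
  moreover have "\<Phi> -` M = UNIV" by (auto simp: M_def)
  ultimately show False using \<gamma>_pos by (simp add: emeasure_\<mu>[OF s] emeasure_lborel_UNIV ennreal_mult_eq_top_iff ennreal_top_eq_mult_iff)
qed

end

lemma affine_subspace_chart:
  fixes A :: "real ^ 'm::finite ^ ('d::finite option)"
  obtains L :: "real ^ 'd \<Rightarrow> real ^ ('d + 'm)" and c where "affine_param L"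
    "\<And>x. append_vec x (tilde_vec x v* A) = affine_param.\<Phi> L c x"
    "affine_subspace A = affine_param.M L c"
proof -
  define L where "L x = (append_vec x (\<chi> k. \<Sum>t\<in>UNIV. x $ t * A $ Some t $ k) :: real ^ ('d + 'm))" for x :: "real ^ 'd"
  define c where "c = (append_vec 0 (A $ None) :: real ^ ('d + 'm))"
  have lin: "linear L"
    by (rule linearI)
      (auto simp: L_def append_vec_def vec_eq_iff sum.distrib algebra_simps sum_distrib_left split: sum.splits)
  have inj: "inj L"
  proof (rule injI)
    fix x y assume "L x = L y"
    then have "L x $ Inl t = L y $ Inl t" for t by simp
    then show "x = y" by (simp add: L_def append_vec_def vec_eq_iff)
  qed
  interpret affine_param L c by (rule affine_param.intro[OF lin inj])
  have chart: "append_vec x (tilde_vec x v* A) = \<Phi> x" for x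
  proof -
    have "(tilde_vec x v* A) $ k = A $ None $ k + (\<Sum>t\<in>UNIV. x $ t * A $ Some t $ k)" for k
      by (simp add: vector_matrix_mult_def tilde_vec_def UNIV_option_conv sum.reindex mult.commute)
    then show ?thesis
      unfolding \<Phi>_def by (auto simp: L_def c_def append_vec_def vec_eq_iff split: sum.splits)
  qed
  show thesis
    by (rule that[OF affine_param_axioms chart])
      (auto simp: affine_subspace_def M_def chart)
qed

lemma affine_subspace_null:
  fixes A :: "real ^ 'm::finite ^ ('d::finite option)"
  assumes "Z \<in> null_sets lborel" "N \<subseteq> affine_subspace A" "\<And>x. append_vec x (tilde_vec x v* A) \<in> N \<Longrightarrow> x \<in> Z"
  shows "N \<in> null_sets (induced_lebesgue TYPE('d) (affine_subspace A))"
proof -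
  obtain L :: "real ^ 'd \<Rightarrow> real ^ ('d + 'm)" and c where *: "affine_param L"
    "\<And>x. append_vec x (tilde_vec x v* A) = affine_param.\<Phi> L c x"
    "affine_subspace A = affine_param.M L c" using affine_subspace_chart by blast
  show ?thesis using affine_param.null_set_via_chart[OF *(1) assms(1)] assms(2,3) unfolding * by blast
qed

lemma affine_subspace_not_null:
  fixes A :: "real ^ 'm::finite ^ ('d::finite option)"
  shows "affine_subspace A \<notin> null_sets (induced_lebesgue TYPE('d) (affine_subspace A))"
proof -
  obtain L :: "real ^ 'd \<Rightarrow> real ^ ('d + 'm)" and c where *: "affine_param L"
    "\<And>x. append_vec x (tilde_vec x v* A) = affine_param.\<Phi> L c x"
    "affine_subspace A = affine_param.M L c" using affine_subspace_chart by blast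
  show ?thesis using affine_param.not_null[OF *(1)] unfolding * .
qed


section \<open>Counting by the dual large sieve\<close>

lemma cis_near_1_iff:
  "cmod (cis (2 * pi * t) - 1) = 2 * \<bar>sin (pi * t)\<bar>"
proof -
  have "(cmod (cis (2 * pi * t) - 1))\<^sup>2 = (cos (2*pi*t) - 1)\<^sup>2 + (sin (2*pi*t))\<^sup>2"
    by (simp add: cmod_power2)
  also have "\<dots> = 2 - 2 * cos (2 * (pi * t))"
    using sin_cos_squared_add[of "2 * pi * t"] by (simp add: power2_eq_square algebra_simps)
  also have "\<dots> = (2 * \<bar>sin (pi * t)\<bar>)\<^sup>2"
    by (subst cos_double_sin) (simp add: power_mult_distrib)
  finally show ?thesis
    by (subst (asm) power2_eq_iff_nonneg) auto
qed

text \<open>Concavity of the sine on \<open>[0, \<pi>]\<close>, compared with the chord from 0 to \<open>\<pi>/2\<close>.\<close>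
lemma sin_pi_ge: 
  assumes "0 \<le> t" "t \<le> 1/2" shows "2 * t \<le> sin (pi * t)"
proof (cases "t = 0 \<or> t = 1/2")
  case True then show ?thesis
  proof
    assume t: "t = 1/2"
    show ?thesis unfolding t by simp
  qed simp
next
  case False
  have "concave_on {0..pi} sin"
  proof (rule f''_le0_imp_concave)
    show "convex {0..pi::real}" by simp
    show "\<And>x. x \<in> {0..pi} \<Longrightarrow> (sin has_real_derivative cos x) (at x)" by (auto intro!: derivative_eq_intros)
    show "\<And>x. x \<in> {0..pi} \<Longrightarrow> (cos has_real_derivative (- sin x)) (at x)" by (auto intro!: derivative_eq_intros)
    show "\<And>x. x \<in> {0..pi} \<Longrightarrow> - sin x \<le> 0" by (auto simp: sin_ge_zero)
  qed
  then have "sin ((1 - 2*t) *\<^sub>R 0 + (2*t) *\<^sub>R (pi/2)) \<ge> (1 - 2*t) * sin 0 + (2*t) * sin (pi/2)"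
    by (rule concave_onD) (use assms in auto)
  then show ?thesis by (simp add: mult.commute)
qed

lemma abs_sin_pi_frac: "\<bar>sin (pi * frac t)\<bar> = \<bar>sin (pi * t)\<bar>"
proof -
  have "cis (2 * pi * t) = cis (2 * pi * frac t)"
  proof -
    have "2 * pi * t = 2 * pi * frac t + 2 * pi * of_int \<lfloor>t\<rfloor>" by (simp add: frac_def algebra_simps)
    then show ?thesis by (simp add: cis_mult[symmetric] cis_multiple_2pi)
  qed
  then show ?thesis using cis_near_1_iff[of t] cis_near_1_iff[of "frac t"] by simp
qed

text \<open>The square of the usual bound \<open>1 / (2 \<parallel>t\<parallel>)\<close> for a geometric exponential sum. The sum of the
  contributions of the two nearest integers replaces the maximum, which makes it easy to sum over
  cells later.\<close>
lemma geometric_exp_sum_bound: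
  assumes "frac t \<noteq> 0"
  shows "(cmod (\<Sum>b<N. cis (2 * pi * (real b * t))))\<^sup>2 \<le> 1 / (4 * (frac t)\<^sup>2) + 1 / (4 * (1 - frac t)\<^sup>2)"
proof -
  define r where "r = frac t"
  have r: "0 < r" "r < 1" using assms frac_ge_0[of t] frac_lt_1[of t] unfolding r_def by linarith+
  have "2 * min r (1 - r) \<le> sin (pi * r)"
  proof (cases "r \<le> 1/2")
    case True then show ?thesis using sin_pi_ge[of r] r by (simp add: min_def)
  next
    case False
    have "sin (pi * (1 - r)) = sin (pi * r)" by (simp add: right_diff_distrib)
    with False show ?thesis using sin_pi_ge[of "1 - r"] r by (simp add: min_def)
  qed
  then have low: "4 * min r (1 - r) \<le> cmod (cis (2 * pi * t) - 1)"
    unfolding cis_near_1_iff abs_sin_pi_frac[symmetric, of t] r_def[symmetric] by linarith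
  define z where "z = cis (2 * pi * t)"
  have mpos: "min r (1 - r) > 0" using r by auto
  have z1: "z \<noteq> 1" using low mpos unfolding z_def by auto
  have "(\<Sum>b<N. cis (2 * pi * (real b * t))) = (\<Sum>b<N. z ^ b)"
    unfolding z_def Complex.DeMoivre by (intro sum.cong) (auto simp: mult_ac)
  also have "\<dots> = (z ^ N - 1) / (z - 1)" using geometric_sum[OF z1] .
  finally have "cmod (\<Sum>b<N. cis (2 * pi * (real b * t))) = cmod (z ^ N - 1) / cmod (z - 1)"
    by (simp add: norm_divide)
  also have "\<dots> \<le> 2 / (4 * min r (1 - r))"
  proof (rule frac_le)
    have "cmod (z ^ N - 1) \<le> cmod (z^N) + cmod 1" by (rule norm_triangle_ineq4)
    then show "cmod (z ^ N - 1) \<le> 2" by (simp add: z_def norm_power)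
  qed (use low mpos z_def in auto)
  finally have "(cmod (\<Sum>b<N. cis (2 * pi * (real b * t))))\<^sup>2 \<le> (2 / (4 * min r (1 - r)))\<^sup>2"
    by (rule power_mono) simp
  also have "\<dots> = 1 / (4 * (min r (1 - r))\<^sup>2)" by (simp add: power_divide power_mult_distrib)
  also have "\<dots> \<le> 1 / (4 * r\<^sup>2) + 1 / (4 * (1 - r)\<^sup>2)"
    by (cases "r \<le> 1 - r") (auto simp: min_def)
  finally show ?thesis unfolding r_def .
qed

text \<open>A bound for the squared exponential sum of length \<open>N\<close> on the \<open>c\<close>-th of the \<open>K\<close> cells
  \<open>[c/K, (c+1)/K)\<close> of the unit interval, as far as the distance to the left end point 0 is
  concerned; the distance to 1 is accounted for by the reflected cell \<open>K - 1 - c\<close>.\<close>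
definition cell_bound :: "nat \<Rightarrow> nat \<Rightarrow> nat \<Rightarrow> real" where
  "cell_bound N K c = (if c = 0 then (real N)\<^sup>2 else (real K)\<^sup>2 / (real c)\<^sup>2)"

lemma cell_bound_nonneg: "cell_bound N K c \<ge> 0"
  by (simp add: cell_bound_def)

lemma exp_sum_cell_bound:
  assumes K: "K > 0" and c: "c = nat \<lfloor>real K * frac t\<rfloor>"
  shows "c < K"
    and "(cmod (\<Sum>b<N. cis (2 * pi * (real b * t))))\<^sup>2 \<le> cell_bound N K c + cell_bound N K (K - 1 - c)"
proof -
  have fr: "0 \<le> frac t" "frac t < 1" using frac_ge_0 frac_lt_1 by auto
  have cle: "real c \<le> real K * frac t" and clt: "real K * frac t < real c + 1"
    unfolding c using fr K by (auto simp: of_nat_nat)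
  have "real K * frac t < real K" using fr K by simp
  then have "real c < real K" using cle by linarith
  then show cK: "c < K" by simp
  show "(cmod (\<Sum>b<N. cis (2 * pi * (real b * t))))\<^sup>2 \<le> cell_bound N K c + cell_bound N K (K - 1 - c)"
  proof (cases "c = 0 \<or> K - 1 - c = 0")
    case True
    have "cmod (\<Sum>b<N. cis (2 * pi * (real b * t))) \<le> (\<Sum>b<N. cmod (cis (2 * pi * (real b * t))))"
      by (rule norm_sum)
    then have "(cmod (\<Sum>b<N. cis (2 * pi * (real b * t))))\<^sup>2 \<le> (real N)\<^sup>2"
      by (intro power_mono) auto
    also have "\<dots> \<le> cell_bound N K c + cell_bound N K (K - 1 - c)"
      using True cell_bound_nonneg[of N K c] cell_bound_nonneg[of N K "K-1-c"] by (auto simp: cell_bound_def)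
    finally show ?thesis .
  next
    case False
    have c1: "real c > 0" and c2: "real (K - 1 - c) > 0" using False by auto
    have "frac t > 0" using c1 cle K by (metis fr(1) less_eq_real_def mult_zero_right not_less)
    have f1: "real c / real K \<le> frac t" using cle K by (simp add: field_simps)
    have "real (K - 1 - c) = real K - 1 - real c" using cK by (simp add: of_nat_diff)
    then have f2: "real (K - 1 - c) / real K \<le> 1 - frac t" using clt K by (simp add: field_simps)
    have "(cmod (\<Sum>b<N. cis (2 * pi * (real b * t))))\<^sup>2 \<le> 1 / (4 * (frac t)\<^sup>2) + 1 / (4 * (1 - frac t)\<^sup>2)"
      using geometric_exp_sum_bound \<open>frac t > 0\<close> by auto
    also have "1 / (4 * (frac t)\<^sup>2) \<le> 1 / (1 * (real c / real K)\<^sup>2)"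
      using f1 c1 K by (intro frac_le mult_mono power_mono) auto
    also have "1 / (4 * (1 - frac t)\<^sup>2) \<le> 1 / (1 * (real (K - 1 - c) / real K)\<^sup>2)"
      using f2 c2 K by (intro frac_le mult_mono power_mono mult_pos_pos zero_less_power divide_pos_pos) auto
    finally show ?thesis using False by (simp add: cell_bound_def power_divide)
  qed
qed

lemma sum_cell_bound:
  "(\<Sum>c<K. cell_bound N K c + cell_bound N K (K - 1 - c)) \<le> 2 * (real N)\<^sup>2 + 4 * (real K)\<^sup>2"
proof -
  have sq: "(\<Sum>c=1..Suc n. 1 / (real c)\<^sup>2) \<le> 2 - 1 / real (Suc n)" for n :: nat
  proof (induction n)
    case (Suc n)
    have "1 / (real (Suc (Suc n)))\<^sup>2 \<le> 1 / (real (Suc n) * real (Suc (Suc n)))"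
      by (intro frac_le) (auto simp: power2_eq_square)
    also have "\<dots> = 1 / real (Suc n) - 1 / real (Suc (Suc n))" by (simp add: field_simps)
    finally show ?case using Suc.IH by simp
  qed simp
  have sq2: "(\<Sum>c=1..<K. 1 / (real c)\<^sup>2) \<le> 2"
  proof -
    have "(\<Sum>c=1..<K. 1 / (real c)\<^sup>2) \<le> (\<Sum>c=1..Suc K. 1 / (real c)\<^sup>2)"
      by (intro sum_mono2) auto
    also have "\<dots> \<le> 2 - 1 / real (Suc K)" by (rule sq)
    also have "\<dots> \<le> 2" by simp
    finally show ?thesis .
  qed
  have half: "(\<Sum>c<K. cell_bound N K c) \<le> (real N)\<^sup>2 + 2 * (real K)\<^sup>2"
  proof (cases "K = 0")
    case False
    then have "{..<K} = insert 0 {1..<K}" by auto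
    then have "(\<Sum>c<K. cell_bound N K c) = (real N)\<^sup>2 + (\<Sum>c=1..<K. (real K)\<^sup>2 * (1 / (real c)\<^sup>2))"
      by (simp add: cell_bound_def)
    also have "(\<Sum>c=1..<K. (real K)\<^sup>2 * (1 / (real c)\<^sup>2)) \<le> (real K)\<^sup>2 * 2"
      unfolding sum_distrib_left[symmetric] by (intro mult_left_mono sq2) simp
    finally show ?thesis by simp
  qed simp
  have "(\<Sum>c<K. cell_bound N K (K - 1 - c)) = (\<Sum>c<K. cell_bound N K c)"
    using sum.nat_diff_reindex[of "cell_bound N K" K] by simp
  then show ?thesis using half by (simp add: sum.distrib)
qed

text \<open>Both sides are the squared Frobenius norm of a Gram matrix, \<open>E E\<^sup>*\<close> on the left and \<open>E\<^sup>* E\<close>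
  on the right, and both traces are \<open>tr (E E\<^sup>* E E\<^sup>*)\<close>. This identity carries the duality of the
  large sieve.\<close>
lemma gram_swap:
  fixes E :: "'b \<Rightarrow> 'j \<Rightarrow> complex"
  assumes "finite B" "finite P"
  shows "(\<Sum>b\<in>B. \<Sum>b'\<in>B. (cmod (\<Sum>j\<in>P. E b j * cnj (E b' j)))\<^sup>2)
       = (\<Sum>j\<in>P. \<Sum>j'\<in>P. (cmod (\<Sum>b\<in>B. E b j * cnj (E b j')))\<^sup>2)"
proof -
  have "complex_of_real (\<Sum>b\<in>B. \<Sum>b'\<in>B. (cmod (\<Sum>j\<in>P. E b j * cnj (E b' j)))\<^sup>2)
     = (\<Sum>b\<in>B. \<Sum>b'\<in>B. \<Sum>j\<in>P. \<Sum>j'\<in>P. (E b j * cnj (E b' j)) * (cnj (E b j') * E b' j'))"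
    by (simp add: complex_norm_square cnj_sum sum_product del: of_real_power)
  also have "\<dots> = (\<Sum>j\<in>P. \<Sum>j'\<in>P. \<Sum>b\<in>B. \<Sum>b'\<in>B. (E b j * cnj (E b' j)) * (cnj (E b j') * E b' j'))"
    by (subst (2) sum.swap, subst sum.swap, intro sum.cong refl, subst (2) sum.swap, subst sum.swap) (rule refl)
  also have "\<dots> = complex_of_real (\<Sum>j\<in>P. \<Sum>j'\<in>P. (cmod (\<Sum>b\<in>B. E b j * cnj (E b j')))\<^sup>2)"
    by (simp add: complex_norm_square cnj_sum sum_product mult_ac del: of_real_power)
  finally show ?thesis using of_real_eq_iff by blast
qed

lemma sum_prod_functions:
  fixes f :: "'k::finite \<Rightarrow> 'a \<Rightarrow> 'c::comm_semiring_1"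
  assumes "finite X"
  shows "(\<Sum>b\<in>{b. \<forall>i. b i \<in> X}. \<Prod>i\<in>UNIV. f i (b i)) = (\<Prod>i\<in>UNIV. \<Sum>x\<in>X. f i x)"
proof -
  have "(\<Prod>i\<in>UNIV. \<Sum>x\<in>X. f i x) = (\<Sum>g\<in>PiE UNIV (\<lambda>_. X). \<Prod>x\<in>UNIV. f x (g x))"
    by (rule prod_sum_PiE) (use assms in auto)
  moreover have "PiE (UNIV :: 'k set) (\<lambda>_. X) = {b. \<forall>i. b i \<in> X}" by (auto simp: PiE_def)
  ultimately show ?thesis by simp
qed

lemma finite_bounded_functions: "finite X \<Longrightarrow> finite {b :: 'k::finite \<Rightarrow> 'a. \<forall>i. b i \<in> X}"
  and card_bounded_functions: "finite X \<Longrightarrow> card {b :: 'k::finite \<Rightarrow> 'a. \<forall>i. b i \<in> X} = card X ^ CARD('k)"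
proof -
  have *: "PiE (UNIV :: 'k set) (\<lambda>_. X) = {b. \<forall>i. b i \<in> X}" by (auto simp: PiE_def)
  show "finite {b :: 'k \<Rightarrow> 'a. \<forall>i. b i \<in> X}" if "finite X"
    unfolding *[symmetric] using that by (intro finite_PiE) auto
  show "card {b :: 'k \<Rightarrow> 'a. \<forall>i. b i \<in> X} = card X ^ CARD('k)" if "finite X"
    unfolding *[symmetric] by (simp add: card_PiE)
qed

lemma cis_sum: "finite S \<Longrightarrow> cis (\<Sum>i\<in>S. f i) = (\<Prod>i\<in>S. cis (f i))"
  by (induction S rule: finite_induct) (auto simp: cis_mult[symmetric])

text \<open>Cut the torus into \<open>K\<^sup>k\<close> cubes of side \<open>1/K\<close>. Separation puts at most one of the points in each
  cube, so the sum over points is at most the sum over all cubes of the bound for the cube, and the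
  latter factors into a product over the coordinates.\<close>
lemma exp_sum_separated_points:
  fixes \<theta> :: "('m::finite \<Rightarrow> nat) \<Rightarrow> 'k::finite \<Rightarrow> real"
  assumes "finite P" "K > 0"
    and sep: "\<And>j j' p. j \<in> P \<Longrightarrow> j' \<in> P \<Longrightarrow> j \<noteq> j' \<Longrightarrow> \<exists>i. \<bar>\<theta> j i - \<theta> j' i - real_of_int (p i)\<bar> \<ge> 1 / real K"
  shows "(\<Sum>j\<in>P. \<Prod>i\<in>UNIV. (cmod (\<Sum>b<N. cis (2 * pi * (real b * \<theta> j i))))\<^sup>2)
     \<le> (2 * (real N)\<^sup>2 + 4 * (real K)\<^sup>2) ^ CARD('k)"
proof -
  \<comment> \<open>\<open>\<kappa> j\<close> is the cube containing the point \<open>\<theta> j\<close> modulo 1.\<close>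
  define \<kappa> where "\<kappa> j i = nat \<lfloor>real K * frac (\<theta> j i)\<rfloor>" for j i
  define G where "G c = cell_bound N K c + cell_bound N K (K - 1 - c)" for c
  have G0: "G c \<ge> 0" for c unfolding G_def by (intro add_nonneg_nonneg cell_bound_nonneg)
  have inj: "inj_on \<kappa> P"
  proof (rule inj_onI, rule ccontr)
    fix j j' assume j: "j \<in> P" "j' \<in> P" "\<kappa> j = \<kappa> j'" "j \<noteq> j'"
    obtain i where i: "\<bar>\<theta> j i - \<theta> j' i - real_of_int (\<lfloor>\<theta> j i\<rfloor> - \<lfloor>\<theta> j' i\<rfloor>)\<bar> \<ge> 1 / real K"
      using sep[OF j(1,2,4), of "\<lambda>i. \<lfloor>\<theta> j i\<rfloor> - \<lfloor>\<theta> j' i\<rfloor>"] by auto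
    have nn: "0 \<le> real K * frac (\<theta> l i)" for l by simp
    have "\<lfloor>real K * frac (\<theta> j i)\<rfloor> = \<lfloor>real K * frac (\<theta> j' i)\<rfloor>"
      using fun_cong[OF j(3), of i] nn unfolding \<kappa>_def by (simp add: nat_eq_iff2 zero_le_floor del: zero_le_mult_iff)
    then have "\<bar>real K * frac (\<theta> j i) - real K * frac (\<theta> j' i)\<bar> < 1" by linarith
    then have "real K * \<bar>frac (\<theta> j i) - frac (\<theta> j' i)\<bar> < 1"
      by (simp add: right_diff_distrib[symmetric] abs_mult)
    moreover have "frac (\<theta> j i) - frac (\<theta> j' i) = \<theta> j i - \<theta> j' i - real_of_int (\<lfloor>\<theta> j i\<rfloor> - \<lfloor>\<theta> j' i\<rfloor>)"
      by (simp add: frac_def)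
    ultimately show False using i assms(2) by (simp add: field_simps)
  qed
  have "(\<Sum>j\<in>P. \<Prod>i\<in>UNIV. (cmod (\<Sum>b<N. cis (2 * pi * (real b * \<theta> j i))))\<^sup>2) \<le> (\<Sum>j\<in>P. \<Prod>i\<in>UNIV. G (\<kappa> j i))"
    unfolding G_def by (intro sum_mono prod_mono conjI exp_sum_cell_bound(2) assms) (auto simp: \<kappa>_def)
  also have "\<dots> = (\<Sum>c\<in>\<kappa> ` P. \<Prod>i\<in>UNIV. G (c i))" by (simp add: sum.reindex[OF inj])
  also have "\<dots> \<le> (\<Sum>c\<in>{c :: 'k \<Rightarrow> nat. \<forall>i. c i \<in> {..<K}}. \<Prod>i\<in>UNIV. G (c i))"
  proof (rule sum_mono2)
    show "finite {c :: 'k \<Rightarrow> nat. \<forall>i. c i \<in> {..<K}}" by (rule finite_bounded_functions) simp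
    show "\<kappa> ` P \<subseteq> {c. \<forall>i. c i \<in> {..<K}}"
      using exp_sum_cell_bound(1)[OF assms(2)] by (auto simp: \<kappa>_def)
  qed (auto intro!: prod_nonneg G0)
  also have "\<dots> = (\<Sum>c<K. G c) ^ CARD('k)" by (subst sum_prod_functions) auto
  also have "\<dots> \<le> (2 * (real N)\<^sup>2 + 4 * (real K)\<^sup>2) ^ CARD('k)"
    unfolding G_def by (intro power_mono sum_cell_bound sum_nonneg add_nonneg_nonneg cell_bound_nonneg)
  finally show ?thesis .
qed

text \<open>All terms have real part at least \<open>1/2\<close>, because every \<open>j t\<close> is within \<open>1/6\<close> of an integer.\<close>
lemma exp_sum_near_integer:
  assumes "\<bar>t - real_of_int p\<bar> \<le> 1 / (6 * real J)"
  shows "real J / 2 \<le> cmod (\<Sum>j<J. cis (2 * pi * (real j * t)))"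
proof -
  have "1 / 2 \<le> Re (cis (2 * pi * (real j * t)))" if "j < J" for j
  proof -
    define s where "s = 2 * pi * (real j * (t - real_of_int p))"
    have "\<bar>real j * (t - real_of_int p)\<bar> \<le> real J * (1 / (6 * real J))"
      unfolding abs_mult using that assms by (intro mult_mono) auto
    also have "\<dots> = 1 / 6" using that by simp
    finally have "2 * pi * \<bar>real j * (t - real_of_int p)\<bar> \<le> 2 * pi * (1/6)" by (intro mult_left_mono) auto
    then have s: "\<bar>s\<bar> \<le> pi / 3" unfolding s_def by (simp add: abs_mult)
    have "1 / 2 = cos (pi / 3)" by (simp add: cos_60)
    also have "\<dots> \<le> cos \<bar>s\<bar>" using s by (intro cos_monotone_0_pi_le) auto
    also have "\<dots> = cos s" by simp
    also have "2 * pi * (real j * t) = s + 2 * pi * real_of_int (int j * p)"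
      unfolding s_def by (simp add: algebra_simps)
    then have "cos s = cos (2 * pi * (real j * t))"
      by (simp only: cos_add) (simp add: sin_int_2pin cos_int_2pin del: of_int_mult)
    finally show ?thesis by simp
  qed
  then have "(\<Sum>j<J. 1/2) \<le> (\<Sum>j<J. Re (cis (2 * pi * (real j * t))))" by (intro sum_mono) auto
  also have "\<dots> = Re (\<Sum>j<J. cis (2 * pi * (real j * t)))" by simp
  also have "\<dots> \<le> cmod (\<Sum>j<J. cis (2 * pi * (real j * t)))" by (rule complex_Re_le_cmod)
  finally show ?thesis by simp
qed

text \<open>The number of representations as a difference of two points of the box of side \<open>2 H\<close> serves as a
  smooth weight: it is nonnegative, at least \<open>H\<^sup>k\<close> on the box of radius \<open>H\<close>, and its exponential sum
  is a square.\<close>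
lemma card_difference_fiber:
  fixes u :: "'k::finite \<Rightarrow> int"
  assumes "\<And>i. \<bar>u i\<bar> \<le> int H"
  defines "B \<equiv> {b :: 'k \<Rightarrow> nat. \<forall>i. b i \<in> {..<2*H}}"
  shows "H ^ CARD('k) \<le> card {(b, b'). b \<in> B \<and> b' \<in> B \<and> (\<lambda>i. int (b i) - int (b' i)) = u}"
proof -
  \<comment> \<open>Translating \<open>c\<close> by the positive and the negative part of \<open>u\<close> gives two points with difference \<open>u\<close>.\<close>
  define f where "f c = ((\<lambda>i. c i + nat (u i)) :: 'k \<Rightarrow> nat, (\<lambda>i. c i + nat (- u i)) :: 'k \<Rightarrow> nat)" for c
  have "inj f" unfolding f_def by (rule injI) (auto simp: fun_eq_iff)
  have "finite B" unfolding B_def by (rule finite_bounded_functions) simp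
  have "card (f ` {c. \<forall>i. c i \<in> {..<H}}) \<le> card {(b, b'). b \<in> B \<and> b' \<in> B \<and> (\<lambda>i. int (b i) - int (b' i)) = u}"
  proof (rule card_mono)
    show "finite {(b, b'). b \<in> B \<and> b' \<in> B \<and> (\<lambda>i. int (b i) - int (b' i)) = u}"
      by (rule finite_subset[of _ "B \<times> B"]) (use \<open>finite B\<close> in auto)
    show "f ` {c. \<forall>i. c i \<in> {..<H}} \<subseteq> {(b, b'). b \<in> B \<and> b' \<in> B \<and> (\<lambda>i. int (b i) - int (b' i)) = u}"
    proof (rule subsetI)
      fix z assume "z \<in> f ` {c. \<forall>i. c i \<in> {..<H}}"
      then obtain c where c: "\<forall>i. c i < H" and z: "z = f c" by auto
      have "c i + nat (u i) < 2 * H \<and> c i + nat (- u i) < 2 * H" for i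
        using c[rule_format, of i] assms(1)[of i] by auto
      then show "z \<in> {(b, b'). b \<in> B \<and> b' \<in> B \<and> (\<lambda>i. int (b i) - int (b' i)) = u}"
        unfolding z f_def B_def by auto
    qed
  qed
  moreover have "card (f ` {c. \<forall>i. c i \<in> {..<H}}) = H ^ CARD('k)"
    using card_bounded_functions[of "{..<H}"] card_image[OF inj_on_subset[OF \<open>inj f\<close> subset_UNIV]] by (metis card_lessThan finite_lessThan)
  ultimately show ?thesis by simp
qed

text \<open>Let \<open>T u\<close> be the exponential sum of \<open>j \<mapsto> u A j\<close> over the box of side \<open>J\<close>. On \<open>U\<close> it has the
  maximal order \<open>J\<^sup>m\<close>. So \<open>|U| J\<^sup>2\<^sup>m\<close> is bounded by the mean square of \<open>T\<close>, taken with the weights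
  of \<open>card_difference_fiber\<close>; by \<open>gram_swap\<close> this mean square is a sum over pairs \<open>j, j'\<close> of squared
  exponential sums over \<open>u\<close> at the points \<open>A (j - j')\<close>, and these points are separated by
  hypothesis.\<close>
lemma large_sieve_count:
  fixes a :: "'k::finite \<Rightarrow> 'm::finite \<Rightarrow> real" and U :: "('k \<Rightarrow> int) set"
  assumes K: "K > 0"
    and sep: "\<And>j :: 'm \<Rightarrow> int. \<And>p :: 'k \<Rightarrow> int. j \<noteq> (\<lambda>_. 0) \<Longrightarrow> (\<And>l. \<bar>j l\<bar> < int J) \<Longrightarrow>
        \<exists>i. \<bar>(\<Sum>l\<in>UNIV. a i l * real_of_int (j l)) - real_of_int (p i)\<bar> \<ge> 1 / real K"
    and box: "\<And>u i. u \<in> U \<Longrightarrow> \<bar>u i\<bar> \<le> int H"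
    and near: "\<And>u l. u \<in> U \<Longrightarrow> \<exists>p. \<bar>(\<Sum>i\<in>UNIV. real_of_int (u i) * a i l) - real_of_int p\<bar> \<le> 1 / (6 * real J)"
  shows "real (card U) * real H ^ CARD('k) * (real J / 2) ^ (2 * CARD('m))
     \<le> real J ^ CARD('m) * (8 * (real H)\<^sup>2 + 4 * (real K)\<^sup>2) ^ CARD('k)"
proof -
  define P where "P = {j :: 'm \<Rightarrow> nat. \<forall>l. j l \<in> {..<J}}"
  define B where "B = {b :: 'k \<Rightarrow> nat. \<forall>i. b i \<in> {..<2*H}}"
  define E where "E b j = cis (2 * pi * (\<Sum>i\<in>UNIV. \<Sum>l\<in>UNIV. real (b i) * a i l * real (j l)))" for b :: "'k \<Rightarrow> nat" and j :: "'m \<Rightarrow> nat"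
  have finP: "finite P" and finB: "finite B" unfolding P_def B_def by (rule finite_bounded_functions; simp)+
  have finU: "finite U"
  proof (rule finite_subset)
    show "U \<subseteq> {u. \<forall>i. u i \<in> {- int H..int H}}" using box by (auto simp: abs_le_iff) (meson minus_le_iff)+
    show "finite {u :: 'k \<Rightarrow> int. \<forall>i. u i \<in> {- int H..int H}}" by (rule finite_bounded_functions) simp
  qed
  define T where "T u = (\<Sum>j\<in>P. cis (2 * pi * (\<Sum>l\<in>UNIV. real (j l) * (\<Sum>i\<in>UNIV. real_of_int (u i) * a i l))))" for u :: "'k \<Rightarrow> int"
  have T_low: "(real J / 2) ^ (2 * CARD('m)) \<le> (cmod (T u))\<^sup>2" if "u \<in> U" for u
  proof -
    define t where "t l = (\<Sum>i\<in>UNIV. real_of_int (u i) * a i l)" for l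
    have "T u = (\<Sum>j\<in>P. \<Prod>l\<in>UNIV. cis (2 * pi * (real (j l) * t l)))"
      unfolding T_def t_def[symmetric] by (simp add: sum_distrib_left cis_sum)
    also have "\<dots> = (\<Prod>l\<in>UNIV. \<Sum>j<J. cis (2 * pi * (real j * t l)))"
      unfolding P_def by (rule sum_prod_functions) simp
    finally have "cmod (T u) = (\<Prod>l\<in>UNIV. cmod (\<Sum>j<J. cis (2 * pi * (real j * t l))))"
      by (simp add: prod_norm)
    moreover have "(\<Prod>l\<in>(UNIV::'m set). real J / 2) \<le> (\<Prod>l\<in>UNIV. cmod (\<Sum>j<J. cis (2 * pi * (real j * t l))))"
    proof (intro prod_mono conjI)
      fix l :: 'm
      obtain p where "\<bar>t l - real_of_int p\<bar> \<le> 1 / (6 * real J)" using near[OF \<open>u \<in> U\<close>, of l] unfolding t_def by auto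
      then show "real J / 2 \<le> cmod (\<Sum>j<J. cis (2 * pi * (real j * t l)))" by (rule exp_sum_near_integer)
    qed simp
    ultimately have "(real J / 2) ^ CARD('m) \<le> cmod (T u)" by simp
    then have "((real J / 2) ^ CARD('m))\<^sup>2 \<le> (cmod (T u))\<^sup>2" by (intro power_mono) auto
    then show ?thesis by (simp add: power_mult[symmetric] mult.commute)
  qed
  have T_E: "T (\<lambda>i. int (b i) - int (b' i)) = (\<Sum>j\<in>P. E b j * cnj (E b' j))" for b b'
    unfolding T_def E_def
  proof (intro sum.cong refl)
    fix j :: "'m \<Rightarrow> nat"
    have "(\<Sum>l\<in>UNIV. real (j l) * (\<Sum>i\<in>UNIV. real_of_int (int (b i) - int (b' i)) * a i l))
      = (\<Sum>i\<in>UNIV. \<Sum>l\<in>UNIV. real (b i) * a i l * real (j l)) - (\<Sum>i\<in>UNIV. \<Sum>l\<in>UNIV. real (b' i) * a i l * real (j l))"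
      unfolding sum_distrib_left sum_subtractf[symmetric]
      by (subst sum.swap) (intro sum.cong refl, simp add: algebra_simps)
    then show "cis (2 * pi * (\<Sum>l\<in>UNIV. real (j l) * (\<Sum>i\<in>UNIV. real_of_int (int (b i) - int (b' i)) * a i l))) =
         cis (2 * pi * (\<Sum>i\<in>UNIV. \<Sum>l\<in>UNIV. real (b i) * a i l * real (j l))) *
         cnj (cis (2 * pi * (\<Sum>i\<in>UNIV. \<Sum>l\<in>UNIV. real (b' i) * a i l * real (j l))))"
      by (simp add: cis_cnj cis_mult right_diff_distrib)
  qed
  have E_prod: "(cmod (\<Sum>b\<in>B. E b j * cnj (E b j')))\<^sup>2
     = (\<Prod>i\<in>UNIV. (cmod (\<Sum>b<2*H. cis (2 * pi * (real b * (\<Sum>l\<in>UNIV. a i l * (real (j l) - real (j' l)))))))\<^sup>2)" for j j'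
  proof -
    have "E b j * cnj (E b j') = (\<Prod>i\<in>UNIV. cis (2 * pi * (real (b i) * (\<Sum>l\<in>UNIV. a i l * (real (j l) - real (j' l))))))" for b
    proof -
      have "(\<Sum>i\<in>UNIV. \<Sum>l\<in>UNIV. real (b i) * a i l * real (j l)) - (\<Sum>i\<in>UNIV. \<Sum>l\<in>UNIV. real (b i) * a i l * real (j' l))
        = (\<Sum>i\<in>UNIV. real (b i) * (\<Sum>l\<in>UNIV. a i l * (real (j l) - real (j' l))))"
        unfolding sum_distrib_left sum_subtractf[symmetric] by (intro sum.cong refl, simp add: algebra_simps)
      then show ?thesis
        unfolding E_def cis_cnj cis_mult cis_sum[OF finite_class.finite_UNIV, symmetric]
        by (simp add: sum_distrib_left[symmetric] right_diff_distrib[symmetric])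
    qed
    then have "(\<Sum>b\<in>B. E b j * cnj (E b j')) = (\<Prod>i\<in>UNIV. \<Sum>b<2*H. cis (2 * pi * (real b * (\<Sum>l\<in>UNIV. a i l * (real (j l) - real (j' l))))))"
      unfolding B_def by (subst sum_prod_functions[symmetric]) auto
    then show ?thesis by (simp add: prod_norm[symmetric] prod_power_distrib)
  qed
  have row: "(\<Sum>j\<in>P. (cmod (\<Sum>b\<in>B. E b j * cnj (E b j')))\<^sup>2) \<le> (8 * (real H)\<^sup>2 + 4 * (real K)\<^sup>2) ^ CARD('k)" if "j' \<in> P" for j'
  proof -
    have "(\<Sum>j\<in>P. (cmod (\<Sum>b\<in>B. E b j * cnj (E b j')))\<^sup>2) \<le> (2 * (real (2*H))\<^sup>2 + 4 * (real K)\<^sup>2) ^ CARD('k)"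
      unfolding E_prod
    proof (rule exp_sum_separated_points[OF finP K])
      fix j1 j2 :: "'m \<Rightarrow> nat" and p :: "'k \<Rightarrow> int"
      assume j: "j1 \<in> P" "j2 \<in> P" "j1 \<noteq> j2"
      have "\<exists>i. \<bar>(\<Sum>l\<in>UNIV. a i l * real_of_int (int (j1 l) - int (j2 l))) - real_of_int (p i)\<bar> \<ge> 1 / real K"
      proof (rule sep)
        show "(\<lambda>l. int (j1 l) - int (j2 l)) \<noteq> (\<lambda>_. 0)" using j(3) by (auto simp: fun_eq_iff)
        show "\<bar>int (j1 l) - int (j2 l)\<bar> < int J" for l using j(1,2) unfolding P_def by (auto dest!: spec[of _ l])
      qed
      moreover have "(\<Sum>l\<in>UNIV. a i l * real_of_int (int (j1 l) - int (j2 l))) =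
         (\<Sum>l\<in>UNIV. a i l * (real (j1 l) - real (j' l))) - (\<Sum>l\<in>UNIV. a i l * (real (j2 l) - real (j' l)))" for i
        unfolding sum_subtractf[symmetric] by (intro sum.cong refl, simp add: algebra_simps)
      ultimately show "\<exists>i. 1 / real K \<le> \<bar>(\<Sum>l\<in>UNIV. a i l * (real (j1 l) - real (j' l))) -
            (\<Sum>l\<in>UNIV. a i l * (real (j2 l) - real (j' l))) - real_of_int (p i)\<bar>" by simp
    qed
    then show ?thesis by (simp add: power_mult_distrib)
  qed
  define F where "F u = {(b, b'). b \<in> B \<and> b' \<in> B \<and> (\<lambda>i. int (b i) - int (b' i)) = u}" for u
  have finF: "finite (F u)" for u
    unfolding F_def by (rule finite_subset[of _ "B \<times> B"]) (use finB in auto)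
  have "real (card U) * real H ^ CARD('k) * (real J / 2) ^ (2 * CARD('m))
      = (\<Sum>u\<in>U. real (H ^ CARD('k)) * (real J / 2) ^ (2 * CARD('m)))" by simp
  also have "\<dots> \<le> (\<Sum>u\<in>U. real (card (F u)) * (cmod (T u))\<^sup>2)"
    unfolding F_def B_def
    by (intro sum_mono mult_mono T_low of_nat_mono card_difference_fiber box) auto
  also have "\<dots> = (\<Sum>u\<in>U. \<Sum>(b,b')\<in>F u. (cmod (T (\<lambda>i. int (b i) - int (b' i))))\<^sup>2)"
    by (intro sum.cong refl, simp add: F_def case_prod_unfold)
  also have "\<dots> = (\<Sum>(b,b')\<in>(\<Union>u\<in>U. F u). (cmod (T (\<lambda>i. int (b i) - int (b' i))))\<^sup>2)"
    by (rule sum.UNION_disjoint[symmetric]) (use finU finF in \<open>auto simp: F_def\<close>)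
  also have "\<dots> \<le> (\<Sum>(b,b')\<in>B \<times> B. (cmod (T (\<lambda>i. int (b i) - int (b' i))))\<^sup>2)"
    by (rule sum_mono2) (use finB in \<open>auto simp: F_def\<close>)
  also have "\<dots> = (\<Sum>b\<in>B. \<Sum>b'\<in>B. (cmod (\<Sum>j\<in>P. E b j * cnj (E b' j)))\<^sup>2)"
    by (simp add: sum.cartesian_product T_E)
  also have "\<dots> = (\<Sum>j\<in>P. \<Sum>j'\<in>P. (cmod (\<Sum>b\<in>B. E b j * cnj (E b j')))\<^sup>2)" by (rule gram_swap[OF finB finP])
  also have "\<dots> = (\<Sum>j'\<in>P. \<Sum>j\<in>P. (cmod (\<Sum>b\<in>B. E b j * cnj (E b j')))\<^sup>2)" by (rule sum.swap)
  also have "\<dots> \<le> (\<Sum>j'\<in>P. (8 * (real H)\<^sup>2 + 4 * (real K)\<^sup>2) ^ CARD('k))" by (intro sum_mono row)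
  also have "\<dots> = real J ^ CARD('m) * (8 * (real H)\<^sup>2 + 4 * (real K)\<^sup>2) ^ CARD('k)"
    using card_bounded_functions[of "{..<J}", where 'k = 'm] by (simp add: P_def)
  finally show ?thesis .
qed


section \<open>Distance to the integer vectors\<close>

lemma infnorm_less_iff: "infnorm (x :: real ^ 'n::finite) < r \<longleftrightarrow> (\<forall>i. \<bar>x $ i\<bar> < r)"
  and infnorm_le_iff: "infnorm x \<le> r \<longleftrightarrow> (\<forall>i. \<bar>x $ i\<bar> \<le> r)"
proof -
  have e: "{\<bar>x $ i\<bar> |i. i \<in> UNIV} = range (\<lambda>i. \<bar>x $ i\<bar>)" by auto
  have "infnorm x = Max (range (\<lambda>i. \<bar>x $ i\<bar>))"
    unfolding infnorm_cart e by (rule cSup_eq_Max) auto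
  then show "infnorm x < r \<longleftrightarrow> (\<forall>i. \<bar>x $ i\<bar> < r)" "infnorm x \<le> r \<longleftrightarrow> (\<forall>i. \<bar>x $ i\<bar> \<le> r)" by auto
qed

lemma infnorm_attained: "\<exists>i. infnorm (x :: real ^ 'n::finite) = \<bar>x $ i\<bar>"
  using infnorm_less_iff[of x "infnorm x"] component_le_infnorm_cart[of x]
  by (metis antisym_conv1 order_less_irrefl)

lemma dist_int_less_iff: 
  "dist_int (y :: real ^ 'n::finite) < r \<longleftrightarrow> (\<exists>p :: 'n \<Rightarrow> int. \<forall>i. \<bar>y $ i - real_of_int (p i)\<bar> < r)"
proof -
  have "bdd_below (range (\<lambda>p. infnorm (y - real_vec p)))"
    by (rule bdd_belowI[of _ 0]) (auto simp: infnorm_pos_le)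
  then have "dist_int y < r \<longleftrightarrow> (\<exists>p. infnorm (y - real_vec p) < r)"
    unfolding dist_int_def by (subst cINF_less_iff) auto
  also have "\<dots> \<longleftrightarrow> (\<exists>p :: int ^ 'n. \<forall>i. \<bar>y $ i - real_of_int (p $ i)\<bar> < r)"
    by (simp add: infnorm_less_iff real_vec_def)
  also have "\<dots> \<longleftrightarrow> (\<exists>p :: 'n \<Rightarrow> int. \<forall>i. \<bar>y $ i - real_of_int (p i)\<bar> < r)"
    by (metis vec_lambda_beta)
  finally show ?thesis .
qed

lemma infnorm_real_vec_ge_1: "q \<noteq> 0 \<Longrightarrow> infnorm (real_vec q) \<ge> 1"
proof -
  assume "q \<noteq> 0"
  then obtain i where "q $ i \<noteq> 0" by (auto simp: vec_eq_iff)
  then have "\<bar>real_vec q $ i\<bar> \<ge> 1" by (simp add: real_vec_def)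
  then show ?thesis using component_le_infnorm_cart[of "real_vec q" i] by linarith
qed

lemma finite_infnorm_real_vec_le: "finite {q :: int ^ 'n::finite. infnorm (real_vec q) \<le> r}"
proof -
  have "{q :: int ^ 'n. infnorm (real_vec q) \<le> r} \<subseteq> vec_lambda ` {f. \<forall>i. f i \<in> {- \<lceil>\<bar>r\<bar>\<rceil>..\<lceil>\<bar>r\<bar>\<rceil>}}"
  proof
    fix q :: "int ^ 'n" assume "q \<in> {q. infnorm (real_vec q) \<le> r}"
    then have "\<bar>real_of_int (q $ i)\<bar> \<le> r" for i by (simp add: infnorm_le_iff real_vec_def)
    then have "q $ i \<in> {- \<lceil>\<bar>r\<bar>\<rceil>..\<lceil>\<bar>r\<bar>\<rceil>}" for i
      by (smt (verit) atLeastAtMost_iff ceiling_correct le_ceiling_iff minus_le_iff of_int_minus ceiling_less_iff of_int_le_iff)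
    then show "q \<in> vec_lambda ` {f. \<forall>i. f i \<in> {- \<lceil>\<bar>r\<bar>\<rceil>..\<lceil>\<bar>r\<bar>\<rceil>}}"
      by (intro image_eqI[of _ _ "vec_nth q"]) auto
  qed
  moreover have "finite {f :: 'n \<Rightarrow> int. \<forall>i. f i \<in> {- \<lceil>\<bar>r\<bar>\<rceil>..\<lceil>\<bar>r\<bar>\<rceil>}}"
    by (rule finite_bounded_functions) simp
  ultimately show ?thesis using finite_surj by blast
qed

lemma dist_int_scale:
  fixes y :: "real ^ 'n::finite"
  assumes "dist_int y < r" "m \<ge> 1"
  shows "dist_int (real m *\<^sub>R y) < real m * r"
proof -
  obtain p where p: "\<And>i. \<bar>y $ i - real_of_int (p i)\<bar> < r" using assms(1) unfolding dist_int_less_iff by auto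
  have "\<bar>(real m *\<^sub>R y) $ i - real_of_int (int m * p i)\<bar> < real m * r" for i
  proof -
    have "(real m *\<^sub>R y) $ i - real_of_int (int m * p i) = real m * (y $ i - real_of_int (p i))"
      by (simp add: algebra_simps)
    then show ?thesis using p[of i] assms(2) by (simp add: abs_mult)
  qed
  then show ?thesis unfolding dist_int_less_iff by (intro exI[of _ "\<lambda>i. int m * p i"]) blast
qed

lemma real_vec_scale: "real_vec (int m *s j) = real m *\<^sub>R real_vec j"
  by (simp add: real_vec_def vec_eq_iff)

lemma logm_ge_1: "logm t \<ge> 1"
  using ln_mono[of "exp 1" t] by (auto simp: logm_def not_le less_imp_le)

lemma logm_ge: "exp r \<le> t \<Longrightarrow> r \<le> logm t"
proof (cases "t \<le> exp 1")
  case True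
  assume "exp r \<le> t"
  with True have "exp r \<le> exp (1::real)" by linarith
  with True show ?thesis by (simp add: logm_def)
next
  case False
  assume "exp r \<le> t"
  then have "ln (exp r) \<le> ln t" by (intro ln_mono) (auto intro: less_le_trans[OF exp_gt_zero])
  with False show ?thesis by (simp add: logm_def)
qed


section \<open>Large logarithmic exponent: approximation inside rational hyperplanes\<close>

text \<open>Arbitrarily good approximations force infinitely many denominators: if there were finitely many,
  one of them would satisfy \<open>\<parallel>q y\<parallel> = 0\<close>, and then all its multiples would qualify.\<close>
lemma simul_approx_criterion:
  fixes y :: "real ^ 'n::finite"
  assumes pos: "\<And>q. q \<ge> 1 \<Longrightarrow> \<psi> q > 0"
    and close: "\<And>\<epsilon>. \<epsilon> > 0 \<Longrightarrow> \<exists>q\<ge>1. dist_int (real q *\<^sub>R y) < \<psi> q \<and> dist_int (real q *\<^sub>R y) < \<epsilon>"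
  shows "y \<in> simul_approx \<psi>"
proof (rule ccontr)
  define S where "S = {q :: nat. q \<ge> 1 \<and> dist_int (real q *\<^sub>R y) < \<psi> q}"
  assume "y \<notin> simul_approx \<psi>"
  then have fin: "finite S" by (simp add: simul_approx_def S_def)
  show False
  proof (cases "\<exists>q\<in>S. dist_int (real q *\<^sub>R y) \<le> 0")
    case True
    then obtain q where q: "q \<ge> 1" "dist_int (real q *\<^sub>R y) \<le> 0" by (auto simp: S_def)
    have "m * q \<in> S" if m: "m \<ge> 1" for m
    proof -
      have mq: "m * q \<ge> 1" using m q by simp
      have "dist_int (real q *\<^sub>R y) < \<psi> (m * q) / real m" using q(2) pos[OF mq] m by (smt (verit) divide_pos_pos of_nat_0_less_iff less_le_trans zero_less_one)
      then have "dist_int (real (m * q) *\<^sub>R y) < \<psi> (m * q)"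
        using dist_int_scale[of "real q *\<^sub>R y" "\<psi> (m * q) / real m" m] m by simp
      then show ?thesis using mq by (simp add: S_def)
    qed
    then have "(\<lambda>m. m * q) ` {1..} \<subseteq> S" by auto
    moreover have "infinite ((\<lambda>m. m * q) ` {1..})"
      using q(1) by (subst finite_image_iff) (auto simp: inj_on_def infinite_Ici)
    ultimately show False using fin finite_subset by blast
  next
    case False
    define \<epsilon> where "\<epsilon> = Min (insert 1 ((\<lambda>q. dist_int (real q *\<^sub>R y)) ` S))"
    have "\<epsilon> > 0" unfolding \<epsilon>_def using fin False by (subst Min_gr_iff) auto
    then obtain q where "q \<ge> 1" "dist_int (real q *\<^sub>R y) < \<psi> q" "dist_int (real q *\<^sub>R y) < \<epsilon>"
      using close by blast
    moreover have "\<epsilon> \<le> dist_int (real q *\<^sub>R y)" if "q \<in> S" unfolding \<epsilon>_def using fin that by (intro Min_le) auto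
    ultimately show False by (simp add: S_def)
  qed
qed

text \<open>The box principle for a point \<open>y\<close> close to the rational hyperplane \<open>v + c \<cdot> y = 0\<close>, with \<open>k\<close> the
  coordinate in which the normal vector is large. Each \<open>q\<close> is put in a box determined by the \<open>n - 1\<close>
  fractional parts of \<open>q y i\<close> for \<open>i \<noteq> k\<close> and by the integer \<open>l q = v q + c \<cdot> \<lfloor>q y\<rfloor>\<close>, which takes few
  values because \<open>c \<cdot> y\<close> is almost \<open>- v\<close>. If two values of \<open>q\<close> share a box, their difference
  approximates \<open>y\<close> well in the coordinates other than \<open>k\<close>; the difference vector lies on the
  rational hyperplane itself, and this controls the coordinate \<open>k\<close>.\<close>
lemma hyperplane_pigeonhole:
  fixes y :: "'i::finite \<Rightarrow> real" and c :: "'i \<Rightarrow> int" and v :: int and k :: 'i and Q N T :: nat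
  assumes ck: "c k \<noteq> 0" and cB: "\<And>i. \<bar>real_of_int (c i)\<bar> \<le> B * \<bar>real_of_int (c k)\<bar>"
    and N: "N \<ge> 1"
  defines "h \<equiv> \<bar>real_of_int (c k)\<bar>"
    and "E \<equiv> \<bar>real_of_int v + (\<Sum>i\<in>UNIV. real_of_int (c i) * y i)\<bar>"
    and "n \<equiv> real CARD('i)"
  assumes T: "real Q * E + n * B * h \<le> real T"
    and large: "(2 * real T + 1) * real N ^ (CARD('i) - 1) < real Q + 1"
  obtains q p where "1 \<le> q" "q \<le> Q" 
    "\<And>i. i \<noteq> k \<Longrightarrow> \<bar>real q * y i - real_of_int (p i)\<bar> < 1 / real N"
    "\<bar>real q * y k - real_of_int (p k)\<bar> \<le> real Q * E / h + n * B / real N"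
proof -
  have h: "h > 0" using ck by (simp add: h_def)
  have B: "B \<ge> 1" using cB[of k] h unfolding h_def[symmetric] by (simp add: mult_le_cancel_right1 not_less[symmetric]) 
  define e where "e = real_of_int v + (\<Sum>i\<in>UNIV. real_of_int (c i) * y i)"
  define l where "l q = v * int q + (\<Sum>i\<in>UNIV. c i * \<lfloor>real q * y i\<rfloor>)" for q :: nat
  \<comment> \<open>The box of \<open>q\<close>, with the value of the linear form in place of the coordinate \<open>k\<close>.\<close>
  define F where "F q i = (if i = k then l q else \<lfloor>real N * frac (real q * y i)\<rfloor>)" for q i
  define X where "X i = (if i = k then {- int T..int T} else {0..<int N})" for i
  have leq: "real_of_int (l q) = real q * e - (\<Sum>i\<in>UNIV. real_of_int (c i) * frac (real q * y i))" for q
    unfolding l_def e_def frac_def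
    by (simp add: algebra_simps sum_distrib_left sum_subtractf)
  have lT: "\<bar>l q\<bar> \<le> int T" if "q \<le> Q" for q
  proof -
    have "\<bar>\<Sum>i\<in>UNIV. real_of_int (c i) * frac (real q * y i)\<bar> \<le> (\<Sum>i\<in>(UNIV::'i set). B * h * 1)"
      by (rule order_trans[OF sum_abs], rule sum_mono, unfold abs_mult, rule mult_mono)
        (use cB h B in \<open>auto simp: h_def abs_of_nonneg frac_lt_1 less_imp_le\<close>)
    moreover have "\<bar>real q * e\<bar> \<le> real Q * E"
      unfolding abs_mult E_def e_def using that by (intro mult_right_mono) auto
    ultimately have "\<bar>real_of_int (l q)\<bar> \<le> real T"
      unfolding leq using T by (simp add: n_def mult.assoc)
    then show ?thesis by linarith
  qed
  have FX: "F ` {0..Q} \<subseteq> PiE UNIV X"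
  proof -
    have "F q i \<in> X i" if "q \<le> Q" for q i
    proof (cases "i = k")
      case True
      then show ?thesis using lT[OF that] by (auto simp: F_def X_def)
    next
      case False
      have "0 \<le> real N * frac (real q * y i)" "real N * frac (real q * y i) < real N"
        using N frac_lt_1[of "real q * y i"] by auto
      then show ?thesis using False by (auto simp: F_def X_def floor_less_iff)
    qed
    then show ?thesis by auto
  qed
  have "card (F ` {0..Q}) \<le> card (PiE UNIV X)" by (intro card_mono finite_PiE FX) (auto simp: X_def)
  also have "card (PiE UNIV X) = (\<Prod>i\<in>UNIV. card (X i))" by (simp add: card_PiE)
  also have "\<dots> = (2 * T + 1) * N ^ (CARD('i) - 1)"
  proof -
    have "(\<Prod>i\<in>UNIV. card (X i)) = card (X k) * (\<Prod>i\<in>UNIV - {k}. card (X i))"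
      by (rule prod.remove) auto
    also have "(\<Prod>i\<in>UNIV - {k}. card (X i)) = (\<Prod>i\<in>UNIV - {k}. N)"
      by (intro prod.cong) (auto simp: X_def)
    also have "card (X k) = 2 * T + 1" by (simp add: X_def nat_add_distrib)
    finally show ?thesis by (simp add: card_Diff_singleton)
  qed
  also have "\<dots> < card {0..Q}"
  proof -
    have "real ((2 * T + 1) * N ^ (CARD('i) - 1)) < real (Q + 1)" using large by (simp add: algebra_simps)
    then show ?thesis unfolding of_nat_less_iff by simp
  qed
  finally have "\<not> inj_on F {0..Q}" by (rule pigeonhole)
  then obtain q1 q2 where q12: "q1 < q2" "q2 \<le> Q" "F q1 = F q2"
    unfolding inj_on_def by (metis atLeastAtMost_iff linorder_neqE_nat)
  define q where "q = q2 - q1"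
  define p where "p i = \<lfloor>real q2 * y i\<rfloor> - \<lfloor>real q1 * y i\<rfloor>" for i
  have rq: "real q = real q2 - real q1" using q12 by (simp add: q_def of_nat_diff)
  have diff: "real q * y i - real_of_int (p i) = frac (real q2 * y i) - frac (real q1 * y i)" for i
    by (simp add: rq p_def frac_def algebra_simps)
  have other: "\<bar>real q * y i - real_of_int (p i)\<bar> < 1 / real N" if "i \<noteq> k" for i
  proof -
    have "\<lfloor>real N * frac (real q1 * y i)\<rfloor> = \<lfloor>real N * frac (real q2 * y i)\<rfloor>"
      using fun_cong[OF q12(3), of i] that by (simp add: F_def)
    then have "\<bar>real N * frac (real q2 * y i) - real N * frac (real q1 * y i)\<bar> < 1" by linarith
    then have "real N * \<bar>frac (real q2 * y i) - frac (real q1 * y i)\<bar> < 1"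
      by (simp add: right_diff_distrib[symmetric] abs_mult)
    then show ?thesis unfolding diff using N by (simp add: field_simps)
  qed
  have "l q1 = l q2" using fun_cong[OF q12(3), of k] by (simp add: F_def)
  then have "real q2 * e - (\<Sum>i\<in>UNIV. real_of_int (c i) * frac (real q2 * y i)) = real q1 * e - (\<Sum>i\<in>UNIV. real_of_int (c i) * frac (real q1 * y i))"
    unfolding leq[symmetric] by simp
  then have "(\<Sum>i\<in>UNIV. real_of_int (c i) * (real q * y i - real_of_int (p i))) = real q * e"
    unfolding diff unfolding rq by (simp add: algebra_simps sum_subtractf)
  then have "real_of_int (c k) * (real q * y k - real_of_int (p k)) = real q * e - (\<Sum>i\<in>UNIV - {k}. real_of_int (c i) * (real q * y i - real_of_int (p i)))"
    by (simp add: sum.remove[of UNIV k])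
  then have "h * \<bar>real q * y k - real_of_int (p k)\<bar> = \<bar>real q * e - (\<Sum>i\<in>UNIV - {k}. real_of_int (c i) * (real q * y i - real_of_int (p i)))\<bar>"
    unfolding h_def abs_mult[symmetric] by simp
  also have "\<dots> \<le> \<bar>real q * e\<bar> + \<bar>\<Sum>i\<in>UNIV - {k}. real_of_int (c i) * (real q * y i - real_of_int (p i))\<bar>"
    by (rule abs_triangle_ineq4)
  also have "\<bar>real q * e\<bar> \<le> real Q * E"
    unfolding abs_mult E_def e_def using q12 by (intro mult_right_mono) (auto simp: q_def)
  also have "\<bar>\<Sum>i\<in>UNIV - {k}. real_of_int (c i) * (real q * y i - real_of_int (p i))\<bar> \<le> (\<Sum>i\<in>UNIV - {k}. B * h * (1 / real N))"
    by (rule order_trans[OF sum_abs], rule sum_mono, unfold abs_mult, rule mult_mono)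
      (use cB h B other in \<open>auto simp: h_def less_imp_le\<close>)
  also have "\<dots> \<le> (\<Sum>i\<in>(UNIV::'i set). B * h * (1 / real N))"
    using B h by (intro sum_mono2) auto
  also have "\<dots> = h * (n * B / real N)" by (simp add: n_def)
  finally have "\<bar>real q * y k - real_of_int (p k)\<bar> \<le> (real Q * E + h * (n * B / real N)) / h"
    using h by (simp add: pos_le_divide_eq mult.commute)
  also have "\<dots> = real Q * E / h + n * B / real N" using h by (simp add: add_divide_distrib)
  finally show thesis using that[of q p] other q12 by (auto simp: q_def)
qed

definition subspace_point :: "real ^ 'm::finite ^ ('d::finite option) \<Rightarrow> real ^ 'd \<Rightarrow> real ^ ('d + 'm)" where
  "subspace_point A x = append_vec x (tilde_vec x v* A)"

lemma subspace_point_nth: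
  "subspace_point A x $ Inl t = x $ t"
  "subspace_point A x $ Inr l = A $ None $ l + (\<Sum>t\<in>UNIV. x $ t * A $ Some t $ l)"
  by (simp_all add: subspace_point_def append_vec_def vector_matrix_mult_def tilde_vec_def UNIV_option_conv sum.reindex mult.commute)

lemma sum_over_Plus: "(\<Sum>i\<in>(UNIV :: ('d::finite + 'm::finite) set). f i) = (\<Sum>t\<in>UNIV. f (Inl t)) + (\<Sum>l\<in>UNIV. f (Inr l))"
proof -
  have "(UNIV :: ('d + 'm) set) = UNIV <+> UNIV" by simp
  then show ?thesis using sum.Plus[of "UNIV :: 'd set" "UNIV :: 'm set" f] by (simp add: o_def)
qed

text \<open>Let \<open>D\<close> be the given bound for \<open>\<parallel>A j\<parallel>\<close> and \<open>p\<close> an integer vector within \<open>D\<close> of \<open>A j\<close>. Then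
  \<open>(1,x) (A j - p)\<close> is at most \<open>C D\<close>. It is the value at \<open>\<Phi> x\<close> of the linear form whose constant
  term is \<open>- p None\<close> and whose coefficients are \<open>- p (Some t)\<close> and \<open>j l\<close>, so the box principle
  applies with \<open>Q\<close> about \<open>h\<^sup>n L\<^sup>b\<close> and cells of width about \<open>1 / (2 n B h L)\<close>. Assumption \<open>L1\<close> makes
  \<open>Q\<close> exceed the number of boxes, and \<open>L2\<close> makes the contribution of the distance to the hyperplane
  less than half of the permitted error.\<close>
lemma good_denominator:
  fixes A :: "real ^ 'm::finite ^ ('d::finite option)" and j :: "int ^ 'm" and x :: "real ^ 'd"
  defines "n \<equiv> CARD('d) + CARD('m)"
    and "h \<equiv> infnorm (real_vec j)"
    and "C \<equiv> 1 + (\<Sum>t\<in>UNIV. \<bar>x $ t\<bar>)"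
    and "B \<equiv> 1 + (\<Sum>i\<in>UNIV. \<Sum>l\<in>UNIV. \<bar>A $ i $ l\<bar>)"
  defines "L \<equiv> logm h"
  assumes j: "j \<noteq> 0"
    and near: "dist_int (A *v real_vec j) < h powr (- real n) * L powr (- w)"
    and bw: "b \<le> w" and w0: "0 \<le> w" and b0: "0 \<le> b"
    and L1: "(4 * C + 2 * real n * B + 3) * (4 * real n * B) ^ (n - 1) < L powr (b - (real n - 1))"
    and L2: "4 * C < L powr (w - 1 - b)"
  shows "\<exists>q. 1 \<le> q \<and> q \<le> nat \<lceil>h ^ n * L powr b\<rceil> \<and> dist_int (real q *\<^sub>R subspace_point A x) < 1 / (h * L)"
proof -
  have h: "h \<ge> 1" unfolding h_def by (rule infnorm_real_vec_ge_1[OF j])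
  have L: "L \<ge> 1" unfolding L_def logm_def by (auto simp: ln_ge_iff not_le le_less_trans[OF exp_ge_zero] less_imp_le intro: order_trans[OF less_imp_le])
  have C: "C \<ge> 1" and B: "B \<ge> 1" unfolding C_def B_def by (auto intro!: sum_nonneg)
  have n2: "n \<ge> 2" unfolding n_def using zero_less_card_finite[where 'a = 'd] zero_less_card_finite[where 'a = 'm] by linarith
  have nn: "real n \<ge> 2" using n2 by simp
  obtain l0 where l0: "h = \<bar>real_vec j $ l0\<bar>" unfolding h_def using infnorm_attained by blast
  define D where "D = h powr (- real n) * L powr (- w)"
  have D0: "D \<ge> 0" by (simp add: D_def)
  have hD: "h powr (- real n) \<le> 1" "L powr (- w) \<le> 1" 
    using h L w0 by (auto simp: powr_minus inverse_le_1_iff ge_one_powr_ge_zero)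
  then have D1: "D \<le> 1" unfolding D_def by (intro mult_le_one) auto
  obtain p :: "'d option \<Rightarrow> int" where p: "\<And>i. \<bar>(A *v real_vec j) $ i - real_of_int (p i)\<bar> < D"
    using near unfolding D_def dist_int_less_iff by blast
  define c :: "'d + 'm \<Rightarrow> int" where "c i = (case i of Inl t \<Rightarrow> - p (Some t) | Inr l \<Rightarrow> j $ l)" for i
  define v where "v = - p None"
  define y where "y i = subspace_point A x $ i" for i
  have hc: "\<bar>real_of_int (c (Inr l0))\<bar> = h" using l0 by (simp add: c_def real_vec_def)
  have rowbound: "(\<Sum>l\<in>UNIV. \<bar>A $ i $ l\<bar>) \<le> B - 1" for i
    unfolding B_def using member_le_sum[of i UNIV "\<lambda>i. \<Sum>l\<in>UNIV. \<bar>A $ i $ l\<bar>"] by (simp add: sum_nonneg)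
  have Aj: "\<bar>(A *v real_vec j) $ i\<bar> \<le> (B - 1) * h" for i
  proof -
    have "\<bar>(A *v real_vec j) $ i\<bar> \<le> (\<Sum>l\<in>UNIV. \<bar>A $ i $ l\<bar> * h)"
      unfolding matrix_vector_mult_def h_def
      by (simp, rule order_trans[OF sum_abs], rule sum_mono, unfold abs_mult, rule mult_left_mono)
        (auto simp: component_le_infnorm_cart)
    also have "\<dots> \<le> (B - 1) * h" unfolding sum_distrib_right[symmetric] using rowbound h by (intro mult_right_mono) auto
    finally show ?thesis .
  qed
  have cB: "\<bar>real_of_int (c i)\<bar> \<le> B * \<bar>real_of_int (c (Inr l0))\<bar>" for i
  proof (cases i)
    case (Inl t)
    have "\<bar>real_of_int (p (Some t))\<bar> \<le> (B - 1) * h + D" using p[of "Some t"] Aj[of "Some t"] by linarith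
    also have "\<dots> \<le> B * h" using D1 h by (simp add: algebra_simps)
    finally show ?thesis unfolding hc using Inl by (simp add: c_def)
  next
    case (Inr l)
    have "\<bar>real_vec j $ l\<bar> \<le> h" unfolding h_def by (rule component_le_infnorm_cart)
    also have "\<dots> \<le> B * h" using B h by simp
    finally show ?thesis unfolding hc using Inr by (simp add: c_def real_vec_def)
  qed
  define E where "E = \<bar>real_of_int v + (\<Sum>i\<in>UNIV. real_of_int (c i) * y i)\<bar>"
  have E: "E \<le> C * D"
  proof -
    have s: "(\<Sum>l\<in>UNIV. real_of_int (j $ l) * subspace_point A x $ Inr l) = (A *v real_vec j) $ None + (\<Sum>t\<in>UNIV. x $ t * (A *v real_vec j) $ Some t)"
    proof -
      have Aj_nth: "(A *v real_vec j) $ i = (\<Sum>l\<in>UNIV. real_of_int (j $ l) * A $ i $ l)" for i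
        by (simp add: matrix_vector_mult_def real_vec_def mult.commute)
      have "(\<Sum>l\<in>UNIV. real_of_int (j $ l) * subspace_point A x $ Inr l)
        = (\<Sum>l\<in>UNIV. real_of_int (j $ l) * A $ None $ l) + (\<Sum>l\<in>UNIV. \<Sum>t\<in>UNIV. x $ t * (real_of_int (j $ l) * A $ Some t $ l))"
        unfolding sum.distrib[symmetric] subspace_point_nth
        by (intro sum.cong refl) (simp add: distrib_left sum_distrib_left mult_ac)
      also have "(\<Sum>l\<in>UNIV. \<Sum>t\<in>UNIV. x $ t * (real_of_int (j $ l) * A $ Some t $ l)) = (\<Sum>t\<in>UNIV. x $ t * (A *v real_vec j) $ Some t)"
        unfolding Aj_nth sum_distrib_left by (rule sum.swap)
      finally show ?thesis unfolding Aj_nth .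
    qed
    have "real_of_int v + (\<Sum>i\<in>UNIV. real_of_int (c i) * y i)
      = ((A *v real_vec j) $ None - real_of_int (p None)) + (\<Sum>t\<in>UNIV. x $ t * ((A *v real_vec j) $ Some t - real_of_int (p (Some t))))"
      unfolding sum_over_Plus y_def c_def v_def
      by (simp add: s subspace_point_nth(1) algebra_simps sum_subtractf sum_negf)
    then have "E \<le> \<bar>(A *v real_vec j) $ None - real_of_int (p None)\<bar> + \<bar>\<Sum>t\<in>UNIV. x $ t * ((A *v real_vec j) $ Some t - real_of_int (p (Some t)))\<bar>"
      unfolding E_def by (simp only: abs_triangle_ineq)
    also have "\<dots> \<le> D + (\<Sum>t\<in>UNIV. \<bar>x $ t\<bar> * D)"
      by (intro add_mono order_trans[OF sum_abs] sum_mono, unfold abs_mult) (auto intro!: mult_left_mono less_imp_le[OF p])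
    also have "\<dots> = C * D" by (simp add: C_def sum_distrib_right[symmetric] distrib_right)
    finally show ?thesis .
  qed
  define R where "R = h ^ n * L powr b"
  have R1: "R \<ge> 1" unfolding R_def using h L b0 by (intro mult_ge1_I one_le_power ge_one_powr_ge_zero) auto
  define Q where "Q = nat \<lceil>R\<rceil>"
  have QR: "R \<le> real Q" "real Q \<le> 2 * R" unfolding Q_def using R1 by linarith+
  have RD: "R * D = L powr (b - w)"
    unfolding R_def D_def using h L by (simp add: powr_realpow[symmetric] powr_add[symmetric] powr_diff powr_minus field_simps)
  have QE: "real Q * E \<le> 2 * C * L powr (b - w)"
  proof -
    have "real Q * E \<le> (2 * R) * (C * D)" using QR E R1 by (intro mult_mono) (auto simp: E_def)
    also have "\<dots> = 2 * C * (R * D)" by simp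
    finally show ?thesis unfolding RD .
  qed
  have "L powr (b - w) \<le> L powr 0" using bw L by (intro powr_mono) auto
  then have QE2: "real Q * E \<le> 2 * C" using QE C L by (smt (verit) mult_left_le powr_zero_eq_one)
  define T where "T = nat \<lceil>2 * C + real n * B * h\<rceil>"
  have T0: "2 * C + real n * B * h \<ge> 0" using C B h by simp
  have T: "2 * C + real n * B * h \<le> real T" "real T \<le> 2 * C + real n * B * h + 1"
    unfolding T_def using T0 by linarith+
  define N where "N = nat \<lceil>2 * real n * B * (h * L)\<rceil>"
  have hL: "h * L \<ge> 1" using h L by (metis mult_ge1_I)
  have nB: "real n * B \<ge> 2" using nn B by (metis mult_mono mult_1_right order_trans zero_le_one zero_le_numeral)
  have N1: "2 * real n * B * (h * L) \<ge> 1"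
  proof -
    have "2 * real n * B \<ge> 1" using nB by simp
    then have "1 * 1 \<le> 2 * real n * B * (h * L)" by (rule mult_mono) (use nB hL in linarith)+
    then show ?thesis by simp
  qed
  have N: "2 * real n * B * (h * L) \<le> real N" "real N \<le> 4 * real n * B * (h * L)"
    unfolding N_def using N1 by linarith+
  have N2: "N \<ge> 1" using N N1 by linarith
  have card_eq: "CARD('d + 'm) = n" by (simp add: n_def)
  have large: "(2 * real T + 1) * real N ^ (n - 1) < real Q + 1"
  proof -
    have "2 * real T + 1 \<le> (4 * C + 2 * real n * B + 3) * h"
    proof -
      have "4 * C * 1 \<le> 4 * C * h" using C h by (intro mult_left_mono) auto
      then show ?thesis using T(2) h by (simp add: algebra_simps)
    qed
    moreover have "real N ^ (n - 1) \<le> (4 * real n * B * (h * L)) ^ (n - 1)" using N by (intro power_mono) auto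
    ultimately have "(2 * real T + 1) * real N ^ (n - 1) \<le> ((4 * C + 2 * real n * B + 3) * h) * (4 * real n * B * (h * L)) ^ (n - 1)"
      using C B h by (intro mult_mono) auto
    also have "\<dots> = ((4 * C + 2 * real n * B + 3) * (4 * real n * B) ^ (n - 1)) * (h * h ^ (n - 1) * L ^ (n - 1))"
      by (simp add: power_mult_distrib)
    also have "h * h ^ (n - 1) = h ^ n" using n2 by (cases n) auto
    also have "((4 * C + 2 * real n * B + 3) * (4 * real n * B) ^ (n - 1)) * (h ^ n * L ^ (n - 1)) < L powr (b - (real n - 1)) * (h ^ n * L ^ (n - 1))"
      using L1 h L by (intro mult_strict_right_mono) auto
    also have "\<dots> = h ^ n * (L powr (b - (real n - 1)) * L powr (real (n - 1)))" using L by (simp add: powr_realpow)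
    also have "\<dots> = R" using n2 by (simp add: R_def powr_add[symmetric] of_nat_diff)
    finally show ?thesis using QR by linarith
  qed
  obtain q r where q: "1 \<le> q" "q \<le> Q" 
    and qi: "\<And>i. i \<noteq> Inr l0 \<Longrightarrow> \<bar>real q * y i - real_of_int (r i)\<bar> < 1 / real N"
    and qk: "\<bar>real q * y (Inr l0) - real_of_int (r (Inr l0))\<bar> \<le> real Q * E / h + real n * B / real N"
  proof (rule hyperplane_pigeonhole[of c "Inr l0" B N Q v y T, unfolded hc card_eq E_def[symmetric]])
    show "c (Inr l0) \<noteq> 0" using hc h by auto
    show "\<bar>real_of_int (c i)\<bar> \<le> B * h" for i using cB[of i] unfolding hc .
    show "real Q * E + real n * B * h \<le> real T" using QE2 T by linarith
  qed (use N2 large in auto)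
  have half: "real n * B / real N \<le> 1 / (2 * (h * L))"
  proof -
    have "real n * B / real N \<le> real n * B / (2 * real n * B * (h * L))"
      using N N1 nB n2 B h L by (intro divide_left_mono mult_pos_pos) auto
    also have "\<dots> = 1 / (2 * (h * L))" using n2 B by simp
    finally show ?thesis .
  qed
  have "real Q * E / h < 1 / (2 * (h * L))"
  proof -
    have "4 * C * (L powr (b - w) * L) < L powr (w - 1 - b) * (L powr (b - w) * L)"
      using L2 L by (intro mult_strict_right_mono) auto
    also have "\<dots> = L powr (w - 1 - b) * (L powr (b - w) * L powr 1)" using L by simp
    also have "\<dots> = 1" unfolding powr_add[symmetric] using L by simp
    finally have lt1: "4 * C * (L powr (b - w) * L) < 1" .
    have "real Q * E * L \<le> 2 * C * L powr (b - w) * L" using QE L by (intro mult_right_mono) auto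
    moreover have "2 * (2 * C * L powr (b - w) * L) = 4 * C * (L powr (b - w) * L)" by simp
    ultimately have "2 * (real Q * E * L) < 1" using lt1 by linarith
    then have "real Q * E * L < 1 / 2" by simp
    then show ?thesis using h L by (simp add: field_simps)
  qed
  then have k: "\<bar>real q * y (Inr l0) - real_of_int (r (Inr l0))\<bar> < 1 / (h * L)"
    using qk half by (simp add: field_simps)
  have "1 / real N \<le> 1 / (h * L)"
  proof -
    have "1 * (h * L) \<le> 2 * real n * B * (h * L)" using nB hL by (intro mult_right_mono) auto
    then have "h * L \<le> real N" using N by linarith
    then show ?thesis using hL h L by (intro divide_left_mono mult_pos_pos) auto
  qed
  then have "\<bar>real q * y i - real_of_int (r i)\<bar> < 1 / (h * L)" for i
    using qi[of i] k by (cases "i = Inr l0") auto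
  then have "dist_int (real q *\<^sub>R subspace_point A x) < 1 / (h * L)"
    unfolding dist_int_less_iff y_def by auto
  then show ?thesis using q unfolding Q_def R_def by blast
qed

text \<open>The exponent \<open>b\<close> lies strictly between \<open>n - 1\<close> and \<open>min n (w - 1)\<close>: the lower bound lets the box
  principle win over every constant, \<open>b < w - 1\<close> controls the distance to the hyperplane, and
  \<open>b < n\<close> makes \<open>Q e\<^sup>n\<close> small. A sequence of vectors \<open>J s\<close> with \<open>Q e\<^sup>n \<le> 2\<^sup>-\<^sup>s\<close> defines \<open>\<psi>\<close>.\<close>
lemma not_khintchine_if_log_exponent_large:
  fixes A :: "real ^ 'm::finite ^ ('d::finite option)"
  defines "n \<equiv> CARD('d) + CARD('m)"
  assumes om: "dioph_exponent A = ereal (real n)" and lom: "log_dioph_exponent A > ereal (real n)"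
  shows "\<not> khintchine_type_convergence TYPE('d) (affine_subspace A)"
proof -
  have n2: "n \<ge> 2" unfolding n_def using zero_less_card_finite[where 'a = 'd] zero_less_card_finite[where 'a = 'm] by linarith
  obtain w where w: "real n < w" and inf: "infinite {q :: int ^ 'm. dist_int (A *v real_vec q)
         < infnorm (real_vec q) powr (- real n) * logm (infnorm (real_vec q)) powr (- w)}" (is "infinite ?Z")
    using lom unfolding log_dioph_exponent_def om less_Sup_iff by auto
  define t where "t = min 1 (w - real n)"
  have t: "0 < t" "t \<le> 1" "t \<le> w - real n" using w by (simp_all add: t_def)
  define b where "b = real n - 1 + t / 2"
  have b: "real n - 1 < b" "b < real n" "b < w - 1" unfolding b_def using t by linarith+
  have b0: "0 \<le> b" using b(1) n2 by linarith
  define h where "h j = infnorm (real_vec j)" for j :: "int ^ 'm"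
  define L where "L j = logm (h j)" for j
  have seq: "\<exists>j\<in>?Z. j \<noteq> 0 \<and> h j \<ge> real s + 1 \<and> L j \<ge> real s \<and> 3 * L j powr (b - real n) \<le> (1/2) ^ s" for s :: nat
  proof -
    have "((\<lambda>l :: real. 3 * l powr (b - real n)) \<longlongrightarrow> 0) at_top"
      using b(2) by (intro tendsto_mult_right_zero tendsto_neg_powr filterlim_ident) auto
    then have "eventually (\<lambda>l. 3 * l powr (b - real n) < (1/2) ^ s) at_top"
      by (rule order_tendstoD(2)) simp
    then obtain l0 where l0: "\<And>l. l \<ge> l0 \<Longrightarrow> 3 * l powr (b - real n) < (1/2) ^ s"
      unfolding eventually_at_top_linorder by blast
    define r where "r = max (exp (max l0 (real s))) (real s + 1)"
    have "finite {q :: int ^ 'm. infnorm (real_vec q) \<le> r}" by (rule finite_infnorm_real_vec_le)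
    then have "\<not> ?Z \<subseteq> {q. infnorm (real_vec q) \<le> r}" using inf finite_subset by blast
    then obtain j where j: "j \<in> ?Z" "\<not> infnorm (real_vec j) \<le> r" by blast
    then have hr: "h j > r" by (simp add: h_def)
    have "h j \<ge> real s + 1" using hr unfolding r_def by linarith
    moreover have "L j \<ge> max l0 (real s)" unfolding L_def using hr by (intro logm_ge) (simp add: r_def)
    moreover have "j \<noteq> 0"
    proof
      assume "j = 0"
      then have "h j = 0" by (simp add: h_def real_vec_def infnorm_0 zero_vec_def[symmetric])
      then show False using \<open>h j \<ge> real s + 1\<close> by simp
    qed
    ultimately show ?thesis using j(1) l0[of "L j"] by (intro bexI[of _ j]) (auto simp: less_imp_le)
  qed
  define J where "J s = (SOME j. j \<in> ?Z \<and> j \<noteq> 0 \<and> h j \<ge> real s + 1 \<and> L j \<ge> real s \<and> 3 * L j powr (b - real n) \<le> (1/2) ^ s)" for s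
  have J: "\<And>s. J s \<in> ?Z" "\<And>s. J s \<noteq> 0" "\<And>s. h (J s) \<ge> real s + 1" "\<And>s. L (J s) \<ge> real s"
      "\<And>s. 3 * L (J s) powr (b - real n) \<le> (1/2) ^ s"
    using someI_ex[OF seq[unfolded Bex_def]] unfolding J_def by blast+
  have h1: "h (J s) \<ge> 1" for s using J(3)[of s] by linarith
  have Ls1: "L (J s) \<ge> 1" for s unfolding L_def by (rule logm_ge_1)
  \<comment> \<open>For \<open>j = J s\<close> the bound for the denominators is \<open>Q s\<close> and the approximation error is \<open>e s\<close>.\<close>
  define e where "e s = 1 / (h (J s) * L (J s))" for s
  define Q where "Q s = nat \<lceil>h (J s) ^ n * L (J s) powr b\<rceil>" for s
  have e0: "e s > 0" for s unfolding e_def using h1[of s] Ls1[of s] by simp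
  have Qs: "real s + 1 \<le> h (J s) ^ n * L (J s) powr b" for s
  proof -
    have "(real s + 1) * 1 \<le> h (J s) ^ n * L (J s) powr b"
    proof (rule mult_mono)
      have "real s + 1 \<le> h (J s) ^ 1" using J(3)[of s] by simp
      also have "\<dots> \<le> h (J s) ^ n" using n2 h1[of s] by (intro power_increasing) auto
      finally show "real s + 1 \<le> h (J s) ^ n" .
      show "1 \<le> L (J s) powr b" using Ls1[of s] b0 by (intro ge_one_powr_ge_zero) auto
    qed (use h1[of s] in auto)
    then show ?thesis by simp
  qed
  have sQ: "s \<le> Q s" for s unfolding Q_def using Qs[of s] by linarith
  have Qe: "(real (Q s) + 1) * e s ^ n \<le> (1/2) ^ s" for s
  proof -
    have "real (Q s) + 1 \<le> 3 * (h (J s) ^ n * L (J s) powr b)" unfolding Q_def using Qs[of s] by linarith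
    then have "(real (Q s) + 1) * e s ^ n \<le> 3 * (h (J s) ^ n * L (J s) powr b) * e s ^ n"
      using e0[of s] by (intro mult_right_mono) auto
    also have "\<dots> = 3 * (L (J s) powr b * (1 / L (J s) ^ n))"
      unfolding e_def using h1[of s] by (simp add: power_mult_distrib power_divide)
    also have "\<dots> = 3 * L (J s) powr (b - real n)"
      using Ls1[of s] by (simp add: powr_diff powr_realpow)
    also have "\<dots> \<le> (1/2) ^ s" by (rule J(5))
    finally show ?thesis .
  qed
  define f where "f q s = e s ^ n * of_bool (q \<le> Q s)" for q s
  have f0: "f q s \<ge> 0" for q s using e0[of s] by (simp add: f_def)
  have fle: "f q s \<le> (1/2) ^ s" for q s
  proof -
    have "f q s \<le> 1 * e s ^ n" using e0[of s] by (simp add: f_def)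
    also have "\<dots> \<le> (real (Q s) + 1) * e s ^ n" using e0[of s] by (intro mult_right_mono) auto
    finally show ?thesis using Qe[of s] by linarith
  qed
  have geo: "summable (\<lambda>s. (1/2 :: real) ^ s)" by (rule summable_geometric) simp
  have sf: "summable (f q)" for q by (rule summable_comparison_test'[OF geo, of 0]) (use f0 fle in auto)
  \<comment> \<open>Adding \<open>n\<close>-th powers of step functions keeps \<open>\<psi>\<close> decreasing and above each of the steps, and
    makes the sum of the \<open>\<psi> q ^ n\<close> a double sum whose inner sums over \<open>q\<close> are at most \<open>(1/2)^s\<close>.\<close>
  define \<psi> where "\<psi> q = root n (suminf (f q))" for q
  have psin: "\<psi> q ^ n = suminf (f q)" for q
    unfolding \<psi>_def using n2 by (intro real_root_pow_pos2 suminf_nonneg sf f0) auto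
  have psi_ge: "e s \<le> \<psi> q" if "q \<le> Q s" for q s
  proof -
    have "sum (f q) {s} \<le> suminf (f q)" using f0 by (intro sum_le_suminf sf) auto
    then have "e s ^ n \<le> suminf (f q)" using that by (simp add: f_def)
    then have "root n (e s ^ n) \<le> \<psi> q" unfolding \<psi>_def using n2 by (intro real_root_le_mono) auto
    then show ?thesis using n2 e0[of s] by (simp add: real_root_power_cancel)
  qed
  have psi_pos: "\<psi> q > 0" for q using psi_ge[OF sQ, of q] e0[of q] by linarith
  have anti: "antimono_on {1..} \<psi>"
  proof (rule monotone_onI)
    fix q r :: nat assume "q \<le> r"
    then have "suminf (f r) \<le> suminf (f q)"
      using e0 by (intro suminf_le sf) (auto simp: f_def less_imp_le)
    then show "\<psi> q \<ge> \<psi> r" unfolding \<psi>_def using n2 by (intro real_root_le_mono) auto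
  qed
  have summ: "summable (\<lambda>q. \<psi> q ^ n)"
  proof (rule summableI_nonneg_bounded)
    show "0 \<le> \<psi> q ^ n" for q using psi_pos[of q] by simp
    fix M :: nat
    have "(\<Sum>q<M. \<psi> q ^ n) = (\<Sum>s. \<Sum>q<M. f q s)" unfolding psin by (intro suminf_sum[symmetric] sf)
    also have "\<dots> \<le> (\<Sum>s. (1/2) ^ s)"
    proof (rule suminf_le[OF _ summable_sum[OF sf] geo])
      fix s
      have "(\<Sum>q<M. f q s) = e s ^ n * real (card ({..<M} \<inter> {q. q \<le> Q s}))"
        unfolding f_def sum_distrib_left[symmetric] by (simp add: sum.If_cases of_bool_def)
      also have "\<dots> \<le> e s ^ n * (real (Q s) + 1)"
      proof (rule mult_left_mono)
        have "card ({..<M} \<inter> {q. q \<le> Q s}) \<le> card {..Q s}" by (intro card_mono) auto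
        then show "real (card ({..<M} \<inter> {q. q \<le> Q s})) \<le> real (Q s) + 1" by simp
      qed (use e0[of s] in simp)
      finally show "(\<Sum>q<M. f q s) \<le> (1/2) ^ s" using Qe[of s] by (simp add: mult.commute)
    qed
    finally show "(\<Sum>q<M. \<psi> q ^ n) \<le> (\<Sum>s. (1/2) ^ s)" .
  qed
  have all: "subspace_point A x \<in> simul_approx \<psi>" for x
  proof (rule simul_approx_criterion)
    fix \<epsilon> :: real assume "\<epsilon> > 0"
    define C where "C = 1 + (\<Sum>t\<in>UNIV. \<bar>x $ t\<bar>)"
    define B where "B = 1 + (\<Sum>i\<in>UNIV. \<Sum>l\<in>UNIV. \<bar>A $ i $ l\<bar>)"
    have ev: "eventually (\<lambda>l :: real. c < l powr p) at_top" if "p > 0" for c p :: real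
    proof (rule eventually_at_top_linorderI)
      fix l :: real assume "(\<bar>c\<bar> + 1) powr (1 / p) \<le> l"
      then have "((\<bar>c\<bar> + 1) powr (1 / p)) powr p \<le> l powr p" using that by (intro powr_mono2) auto
      then show "c < l powr p" using that by (simp add: powr_powr)
    qed
    have "eventually (\<lambda>l :: real. (4 * C + 2 * real n * B + 3) * (4 * real n * B) ^ (n - 1) < l powr (b - (real n - 1))
        \<and> 4 * C < l powr (w - 1 - b)) at_top"
      using b by (intro eventually_conj ev) auto
    then obtain l0 where l0: "\<And>l. l \<ge> l0 \<Longrightarrow> (4 * C + 2 * real n * B + 3) * (4 * real n * B) ^ (n - 1) < l powr (b - (real n - 1))
        \<and> 4 * C < l powr (w - 1 - b)" unfolding eventually_at_top_linorder by blast
    obtain s :: nat where s: "real s \<ge> max l0 (1 / \<epsilon>)" using real_arch_simple by blast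
    have Lsl0: "L (J s) \<ge> l0" using J(4)[of s] s by simp
    have "e s \<le> \<epsilon>"
    proof -
      have "1 / \<epsilon> \<le> real s" using s by simp
      also have "\<dots> \<le> h (J s)" using J(3)[of s] by simp
      also have "\<dots> = h (J s) * 1" by simp
      also have "\<dots> \<le> h (J s) * L (J s)" using h1[of s] Ls1[of s] by (intro mult_left_mono) auto
      finally show ?thesis using \<open>\<epsilon> > 0\<close> h1[of s] Ls1[of s] by (simp add: e_def field_simps)
    qed
    have "\<exists>q. 1 \<le> q \<and> q \<le> Q s \<and> dist_int (real q *\<^sub>R subspace_point A x) < e s"
      unfolding Q_def e_def h_def L_def n_def
    proof (rule good_denominator[where w = w])
      show "dist_int (A *v real_vec (J s)) < infnorm (real_vec (J s)) powr - real (CARD('d) + CARD('m)) * logm (infnorm (real_vec (J s))) powr - w"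
        using J(1)[of s] by (simp add: n_def)
    qed (use J(2) b b0 w l0[OF Lsl0] in \<open>auto simp: n_def C_def B_def L_def h_def\<close>)
    then show "\<exists>q\<ge>1. dist_int (real q *\<^sub>R subspace_point A x) < \<psi> q \<and> dist_int (real q *\<^sub>R subspace_point A x) < \<epsilon>"
      using psi_ge[of _ s] \<open>e s \<le> \<epsilon>\<close> by force
  qed (use psi_pos in auto)
  then have "simul_approx \<psi> \<inter> affine_subspace A = affine_subspace A"
    by (auto simp: affine_subspace_def subspace_point_def)
  moreover have "CARD('d + 'm) = n" by (simp add: n_def)
  ultimately have "\<not> (simul_approx \<psi> \<inter> affine_subspace A \<in> null_sets (induced_lebesgue TYPE('d) (affine_subspace A)))"
    and "summable (\<lambda>q. \<psi> q ^ CARD('d + 'm))"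
    using affine_subspace_not_null[of A] summ by simp_all
  moreover have "\<forall>q\<ge>1. 0 \<le> \<psi> q" using psi_pos by (auto intro: less_imp_le)
  ultimately show ?thesis
    unfolding khintchine_type_convergence_def using anti by blast
qed


section \<open>Small logarithmic exponent: counting rational points near the subspace\<close>

text \<open>For a real \<open>w\<close> above the logarithmic exponent and below \<open>-1\<close> only finitely many \<open>j\<close> violate the
  bound with \<open>\<beta> = - w\<close> and constant 1. The finitely many exceptions are absorbed in the constant,
  since \<open>\<parallel>A j\<parallel>\<close> is never zero: otherwise all multiples of \<open>j\<close> would be exceptions.\<close>
lemma dist_int_lower_bound:
  fixes A :: "real ^ 'm::finite ^ 'k::finite" and n :: nat
  assumes om: "dioph_exponent A = ereal (real n)" and lom: "log_dioph_exponent A < - 1"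
  obtains \<beta> c where "\<beta> > 1" "c > 0" 
    "\<And>j :: int ^ 'm. j \<noteq> 0 \<Longrightarrow> c * (infnorm (real_vec j) powr (- real n) * logm (infnorm (real_vec j)) powr \<beta>) \<le> dist_int (A *v real_vec j)"
proof -
  define g where "g w j = infnorm (real_vec j) powr (- real n) * logm (infnorm (real_vec j)) powr (- w)" for w and j :: "int ^ 'm"
  obtain w where w: "log_dioph_exponent A < ereal w" "ereal w < - 1" using ereal_dense2[OF lom] by blast
  have w1: "w < - 1" using w(2) by (simp add: one_ereal_def)
  have fin: "finite {j. dist_int (A *v real_vec j) < g w j}" (is "finite ?Z")
  proof (rule ccontr)
    assume "infinite ?Z"
    then have "ereal w \<le> log_dioph_exponent A"
      unfolding log_dioph_exponent_def om g_def by (intro Sup_upper) auto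
    then show False using w(1) by simp
  qed
  have gpos: "g w' j > 0" if "j \<noteq> 0" for w' j
  proof -
    have "logm (infnorm (real_vec j)) > 0" using logm_ge_1[of "infnorm (real_vec j)"] by linarith
    then show ?thesis unfolding g_def using infnorm_real_vec_ge_1[OF that] by simp
  qed
  have dpos: "dist_int (A *v real_vec j) > 0" if j: "j \<noteq> 0" for j
  proof (rule ccontr)
    assume "\<not> dist_int (A *v real_vec j) > 0"
    then have d0: "dist_int (A *v real_vec j) \<le> 0" by simp
    have "int m *s j \<in> ?Z" if m: "m \<ge> 1" for m
    proof -
      have "int m *s j \<noteq> 0" using j m by (auto simp: vec_eq_iff)
      then have gp: "g w (int m *s j) > 0" by (rule gpos)
      have "dist_int (A *v real_vec j) < g w (int m *s j) / real m" using d0 gp m by (smt (verit) divide_pos_pos of_nat_0_less_iff less_le_trans zero_less_one)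
      then have "dist_int (real m *\<^sub>R (A *v real_vec j)) < real m * (g w (int m *s j) / real m)"
        using m by (rule dist_int_scale)
      then show ?thesis using m by (simp add: real_vec_scale matrix_vector_mult_scaleR)
    qed
    then have "(\<lambda>m. int m *s j) ` {1..} \<subseteq> ?Z" by auto
    moreover have "inj_on (\<lambda>m. int m *s j) {1..}"
    proof -
      obtain i where "j $ i \<noteq> 0" using j by (auto simp: vec_eq_iff)
      then show ?thesis by (intro inj_onI) (auto simp: vec_eq_iff)
    qed
    ultimately have "finite {1::nat..}" using fin by (metis finite_image_iff finite_subset)
    then show False by (simp add: infinite_Ici)
  qed
  define c where "c = Min (insert 1 ((\<lambda>j. dist_int (A *v real_vec j) / g w j) ` (?Z - {0})))"
  have c0: "c > 0" unfolding c_def using fin dpos gpos by (subst Min_gr_iff) auto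
  show thesis
  proof (rule that[of "- w" c])
    fix j :: "int ^ 'm" assume j: "j \<noteq> 0"
    have "c * g w j \<le> dist_int (A *v real_vec j)"
    proof (cases "j \<in> ?Z")
      case True
      then have "c \<le> dist_int (A *v real_vec j) / g w j"
        unfolding c_def using fin j by (intro Min_le) auto
      then show ?thesis using gpos[OF j, of w] by (simp add: pos_le_divide_eq)
    next
      case False
      have "c \<le> 1" unfolding c_def using fin by (intro Min_le) auto
      then have "c * g w j \<le> 1 * g w j" using gpos[OF j, of w] by (intro mult_right_mono) auto
      then show ?thesis using False by simp
    qed
    then show "c * (infnorm (real_vec j) powr - real n * logm (infnorm (real_vec j)) powr - w) \<le> dist_int (A *v real_vec j)"
      by (simp add: g_def)
  qed (use w1 c0 in auto)
qed

text \<open>The bound for \<open>\<parallel>A j\<parallel>\<close> is evaluated on the range \<open>|j|\<^sup>n \<le> 2\<^sup>k (k+1)\<^sup>\<beta>\<close>. If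
  \<open>|j| \<ge> 2\<^sup>k\<^sup>/\<^sup>2\<^sup>n\<close>, then \<open>log |j|\<close> is of order \<open>k\<close> and the powers of \<open>k\<close> cancel; if \<open>|j|\<close> is smaller,
  then already \<open>|j|\<^sup>-\<^sup>n \<ge> 2\<^sup>-\<^sup>k\<^sup>/\<^sup>2\<close>.\<close>
lemma dyadic_separation:
  fixes A :: "real ^ 'm::finite ^ 'k::finite" and n :: nat
  assumes n: "n \<ge> 1" and beta: "\<beta> > 1" and c: "c > 0"
    and low: "\<And>j :: int ^ 'm. j \<noteq> 0 \<Longrightarrow> c * (infnorm (real_vec j) powr (- real n) * logm (infnorm (real_vec j)) powr \<beta>) \<le> dist_int (A *v real_vec j)"
  obtains c' where "0 < c'" "c' \<le> 1"
    "\<And>k :: nat. \<And>j :: int ^ 'm. j \<noteq> 0 \<Longrightarrow> infnorm (real_vec j) \<le> 2 powr (real k / real n) * (real k + 1) powr (\<beta> / real n)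
      \<Longrightarrow> c' / 2 ^ k \<le> dist_int (A *v real_vec j)"
proof -
  \<comment> \<open>\<open>log |j|\<close> is at least 1 and at least \<open>k ln 2 / (2 n)\<close>, which gives \<open>k + 1 \<le> a log |j|\<close>.\<close>
  define a where "a = 1 + 2 * real n / ln 2"
  have a: "a \<ge> 1" using n by (simp add: a_def)
  define c' where "c' = min 1 (c * a powr (- \<beta>))"
  have apos: "a powr (- \<beta>) > 0" using a by simp
  have ale: "a powr (- \<beta>) \<le> 1" using a beta by (simp add: powr_minus inverse_le_1_iff ge_one_powr_ge_zero)
  show thesis
  proof (rule that[of c'])
    show "0 < c'" "c' \<le> 1" unfolding c'_def using c apos by auto
    fix k :: nat and j :: "int ^ 'm"
    assume j: "j \<noteq> 0" and hle: "infnorm (real_vec j) \<le> 2 powr (real k / real n) * (real k + 1) powr (\<beta> / real n)"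
    define h where "h = infnorm (real_vec j)"
    define L where "L = logm h"
    have h1: "h \<ge> 1" unfolding h_def by (rule infnorm_real_vec_ge_1[OF j])
    have L1: "L \<ge> 1" unfolding L_def by (rule logm_ge_1)
    have "c' / 2 ^ k \<le> c * (h powr (- real n) * L powr \<beta>)"
    proof (cases "2 powr (real k / (2 * real n)) \<le> h")
      case True
      have "exp (real k * ln 2 / (2 * real n)) \<le> h" using True by (simp add: powr_def)
      then have "real k * ln 2 / (2 * real n) \<le> L" unfolding L_def by (rule logm_ge)
      then have "real k \<le> 2 * real n / ln 2 * L" using n by (simp add: field_simps)
      then have "real k + 1 \<le> a * L" unfolding a_def using L1 by (simp add: algebra_simps)
      then have "(real k + 1) / a \<le> L" using a by (simp add: pos_divide_le_eq mult.commute)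
      then have "((real k + 1) / a) powr \<beta> \<le> L powr \<beta>" using a beta by (intro powr_mono2) auto
      then have Lb: "(real k + 1) powr \<beta> * a powr (- \<beta>) \<le> L powr \<beta>"
        using a by (subst (asm) powr_divide) (auto simp: powr_minus divide_inverse)
      have "(2 powr (real k / real n) * (real k + 1) powr (\<beta> / real n)) powr (- real n) \<le> h powr (- real n)"
        using hle h1 n unfolding h_def[symmetric] by (intro powr_mono2') auto
      moreover have "(2 powr (real k / real n) * (real k + 1) powr (\<beta> / real n)) powr (- real n) = 1 / 2 ^ k * (real k + 1) powr (- \<beta>)"
        using n by (simp add: powr_mult powr_powr powr_minus powr_realpow[symmetric] inverse_eq_divide)
      ultimately have hb: "1 / 2 ^ k * (real k + 1) powr (- \<beta>) \<le> h powr (- real n)" by simp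
      have "c' / 2 ^ k \<le> c * a powr (- \<beta>) / 2 ^ k" unfolding c'_def by (intro divide_right_mono) auto
      also have "\<dots> = c * ((1 / 2 ^ k * (real k + 1) powr (- \<beta>)) * ((real k + 1) powr \<beta> * a powr (- \<beta>)))"
      proof -
        have "(real k + 1) powr (- \<beta>) * (real k + 1) powr \<beta> = 1" by (simp add: powr_add[symmetric])
        then show ?thesis by (simp add: field_simps)
      qed
      also have "\<dots> \<le> c * (h powr (- real n) * L powr \<beta>)"
        using c hb Lb by (intro mult_left_mono mult_mono) auto
      finally show ?thesis .
    next
      case False
      then have "h \<le> 2 powr (real k / (2 * real n))" by simp
      then have "(2 powr (real k / (2 * real n))) powr (- real n) \<le> h powr (- real n)"
        using h1 by (intro powr_mono2') auto
      moreover have "(2 powr (real k / (2 * real n))) powr (- real n) = 2 powr (- (real k / 2))"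
        using n by (simp add: powr_powr)
      moreover have "(2::real) powr (- real k) \<le> 2 powr (- (real k / 2))" by (intro powr_mono) auto
      moreover have "(2::real) powr (- real k) = 1 / 2 ^ k" by (simp add: powr_minus powr_realpow inverse_eq_divide)
      ultimately have hb: "1 / 2 ^ k \<le> h powr (- real n)" by linarith
      have Lb: "1 \<le> L powr \<beta>" using L1 beta by (intro ge_one_powr_ge_zero) auto
      have "c' \<le> c * 1" unfolding c'_def using mult_left_mono[OF ale, of c] c by linarith
      then have "c' / 2 ^ k \<le> c * (1 / 2 ^ k * 1)" by (simp add: divide_right_mono)
      also have "\<dots> \<le> c * (h powr (- real n) * L powr \<beta>)"
        using c hb Lb by (intro mult_left_mono mult_mono) auto
      finally show ?thesis .
    qed
    then show "c' / 2 ^ k \<le> dist_int (A *v real_vec j)" using low[OF j] unfolding h_def L_def by linarith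
  qed
qed

text \<open>The width \<open>C \<delta>\<close> and the box of radius \<open>R 2\<^sup>k\<close> would give the bound \<open>\<delta>\<^sup>m (2\<^sup>k)\<^sup>D\<close>, up to a
  constant, if the vectors \<open>u A\<close> were equidistributed modulo 1, where \<open>D\<close> is the number of rows of
  \<open>A\<close>. The large sieve with \<open>J\<close> about \<open>1 / (6 C \<delta>)\<close>, \<open>H = R 2\<^sup>k\<close> and \<open>K\<close> about \<open>2\<^sup>k / c'\<close> loses only
  a constant against this, because \<open>H\<close> and \<open>K\<close> have the same order.\<close>
lemma dyadic_count:
  fixes A :: "real ^ 'm::finite ^ 'k::finite" and c' C R :: real
  assumes c': "0 < c'" "c' \<le> 1" and C: "C \<ge> 1"
    and R: "R \<ge> 1"
  defines "M \<equiv> 4 ^ CARD('m) * (12 * C) ^ CARD('m) * ((8 * R\<^sup>2 + 16 / c'\<^sup>2) / R) ^ CARD('k)"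
  assumes sep: "\<And>j :: int ^ 'm. j \<noteq> 0 \<Longrightarrow> infnorm (real_vec j) \<le> 1 / \<delta> \<Longrightarrow> c' / 2 ^ k \<le> dist_int (A *v real_vec j)"
    and \<delta>: "0 < \<delta>" "6 * C * \<delta> \<le> 1" and RN: "R \<in> \<nat>"
    and box: "\<And>u i. u \<in> U \<Longrightarrow> \<bar>real_of_int (u i)\<bar> \<le> R * 2 ^ k"
    and near: "\<And>u l. u \<in> U \<Longrightarrow> \<exists>p. \<bar>(\<Sum>i\<in>UNIV. real_of_int (u i) * A $ i $ l) - real_of_int p\<bar> \<le> C * \<delta>"
  shows "real (card U) \<le> M * \<delta> ^ CARD('m) * (2 ^ k) ^ CARD('k)"
proof -
  define J where "J = nat \<lfloor>1 / (6 * C * \<delta>)\<rfloor>"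
  have cd: "6 * C * \<delta> > 0" using C \<delta> by simp
  then have ge1: "1 / (6 * C * \<delta>) \<ge> 1" using \<delta> by simp
  then have J: "J \<ge> 1" "real J \<le> 1 / (6 * C * \<delta>)" "1 / (6 * C * \<delta>) \<le> 2 * real J"
  proof -
    have fl: "1 \<le> \<lfloor>1 / (6 * C * \<delta>)\<rfloor>" using ge1 by (simp only: le_floor_iff of_int_1)
    then have "int J = \<lfloor>1 / (6 * C * \<delta>)\<rfloor>" unfolding J_def by (intro nat_0_le) linarith
    then have "1 \<le> int J" "real J = of_int \<lfloor>1 / (6 * C * \<delta>)\<rfloor>" using fl by linarith+
    then show "J \<ge> 1" "real J \<le> 1 / (6 * C * \<delta>)" "1 / (6 * C * \<delta>) \<le> 2 * real J" by linarith+
  qed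
  obtain r :: nat where r: "R = real r" using RN by (auto simp: Nats_def)
  define H where "H = r * 2 ^ k"
  have H: "real H = R * 2 ^ k" by (simp add: H_def r)
  have H0: "H > 0" using R by (simp add: H_def r)
  define K where "K = nat \<lceil>2 ^ k / c'\<rceil>"
  have "(1::real) \<le> 2 ^ k / c'" using c' by (simp add: pos_le_divide_eq order_trans[OF _ one_le_power])
  then have K: "2 ^ k / c' \<le> real K" "real K \<le> 2 * (2 ^ k / c')" "K > 0" unfolding K_def by linarith+
  have Kc: "1 / real K \<le> c' / 2 ^ k"
  proof -
    have "1 / real K \<le> 1 / (2 ^ k / c')" using K c' by (intro divide_left_mono) auto
    then show ?thesis by simp
  qed
  have ls: "real (card U) * real H ^ CARD('k) * (real J / 2) ^ (2 * CARD('m))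
     \<le> real J ^ CARD('m) * (8 * (real H)\<^sup>2 + 4 * (real K)\<^sup>2) ^ CARD('k)"
  proof (rule large_sieve_count[where a = "\<lambda>i l. A $ i $ l"])
    show "K > 0" by fact
    fix j :: "'m \<Rightarrow> int" and p :: "'k \<Rightarrow> int"
    assume j0: "j \<noteq> (\<lambda>_. 0)" and jJ: "\<And>l. \<bar>j l\<bar> < int J"
    define j' where "j' = (\<chi> l. j l)"
    have "j' \<noteq> 0" using j0 by (auto simp: j'_def vec_eq_iff fun_eq_iff)
    moreover have "infnorm (real_vec j') \<le> 1 / \<delta>"
    proof -
      have "\<bar>real_of_int (j l)\<bar> \<le> real J" for l using jJ[of l] by linarith
      then have "infnorm (real_vec j') \<le> real J" by (simp add: infnorm_le_iff real_vec_def j'_def)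
      also have "\<dots> \<le> 1 / (6 * C * \<delta>)" by (rule J(2))
      also have "\<dots> \<le> 1 / \<delta>" using C \<delta> by (intro divide_left_mono) auto
      finally show ?thesis .
    qed
    ultimately have "1 / real K \<le> dist_int (A *v real_vec j')" using sep Kc by (meson order_trans)
    then have "\<not> dist_int (A *v real_vec j') < 1 / real K" by simp
    then obtain i where "\<not> \<bar>(A *v real_vec j') $ i - real_of_int (p i)\<bar> < 1 / real K"
      unfolding dist_int_less_iff by blast
    then show "\<exists>i. 1 / real K \<le> \<bar>(\<Sum>l\<in>UNIV. A $ i $ l * real_of_int (j l)) - real_of_int (p i)\<bar>"
      by (intro exI[of _ i]) (simp add: matrix_vector_mult_def real_vec_def j'_def)
  next
    fix u i assume "u \<in> U"
    then have "\<bar>real_of_int (u i)\<bar> \<le> real H" using box H by simp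
    then show "\<bar>u i\<bar> \<le> int H" by linarith
  next
    fix u l assume u: "u \<in> U"
    have "C * \<delta> \<le> 1 / (6 * real J)"
      using J(1,2) cd by (simp add: field_simps)
    then show "\<exists>p. \<bar>(\<Sum>i\<in>UNIV. real_of_int (u i) * A $ i $ l) - real_of_int p\<bar> \<le> 1 / (6 * real J)"
      using near[OF u, of l] by (meson order_trans)
  qed
  have "8 * (real H)\<^sup>2 + 4 * (real K)\<^sup>2 \<le> (8 * R\<^sup>2 + 16 / c'\<^sup>2) * (2 ^ k)\<^sup>2"
  proof -
    have "(real K)\<^sup>2 \<le> (2 * (2 ^ k / c'))\<^sup>2" using K by (intro power_mono) auto
    then show ?thesis unfolding H by (simp add: power_mult_distrib power_divide algebra_simps)
  qed
  also have "\<dots> = ((8 * R\<^sup>2 + 16 / c'\<^sup>2) / R) * 2 ^ k * real H"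
    unfolding H using R by (simp add: power2_eq_square)
  finally have "(8 * (real H)\<^sup>2 + 4 * (real K)\<^sup>2) ^ CARD('k) \<le> (((8 * R\<^sup>2 + 16 / c'\<^sup>2) / R) * 2 ^ k * real H) ^ CARD('k)"
    by (intro power_mono) auto
  then have 1: "(8 * (real H)\<^sup>2 + 4 * (real K)\<^sup>2) ^ CARD('k) \<le> ((8 * R\<^sup>2 + 16 / c'\<^sup>2) / R) ^ CARD('k) * (2 ^ k) ^ CARD('k) * real H ^ CARD('k)"
    by (simp only: power_mult_distrib)
  have 2: "(real J / 2) ^ (2 * CARD('m)) = real J ^ CARD('m) * (real J / 4) ^ CARD('m)"
    by (simp add: power_mult power_mult_distrib[symmetric] power2_eq_square)
  have "real J ^ CARD('m) * real H ^ CARD('k) * (real (card U) * (real J / 4) ^ CARD('m))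
     \<le> real J ^ CARD('m) * (8 * (real H)\<^sup>2 + 4 * (real K)\<^sup>2) ^ CARD('k)"
    using ls unfolding 2 by (simp add: mult_ac)
  also have "\<dots> \<le> real J ^ CARD('m) * (((8 * R\<^sup>2 + 16 / c'\<^sup>2) / R) ^ CARD('k) * (2 ^ k) ^ CARD('k) * real H ^ CARD('k))"
    using 1 by (intro mult_left_mono) auto
  also have "\<dots> = real J ^ CARD('m) * real H ^ CARD('k) * (((8 * R\<^sup>2 + 16 / c'\<^sup>2) / R) ^ CARD('k) * (2 ^ k) ^ CARD('k))"
    by (simp only: mult_ac)
  finally have 3: "real (card U) * (real J / 4) ^ CARD('m) \<le> ((8 * R\<^sup>2 + 16 / c'\<^sup>2) / R) ^ CARD('k) * (2 ^ k) ^ CARD('k)"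
    by (rule mult_left_le_imp_le) (use J(1) H0 in simp)
  have "1 \<le> (12 * C * \<delta>) * real J"
    using J(3) cd by (simp add: field_simps)
  then have "1 \<le> ((12 * C * \<delta>) * real J) ^ CARD('m)" by (rule one_le_power)
  then have "real (card U) * 1 \<le> real (card U) * ((12 * C * \<delta>) * real J) ^ CARD('m)" by (intro mult_left_mono) auto
  also have "(12 * C * \<delta>) * real J = (4 * (12 * C) * \<delta>) * (real J / 4)" by simp
  also have "real (card U) * \<dots> ^ CARD('m) = (4 * (12 * C) * \<delta>) ^ CARD('m) * (real (card U) * (real J / 4) ^ CARD('m))"
    by (simp only: power_mult_distrib mult_ac)
  also have "\<dots> \<le> (4 * (12 * C) * \<delta>) ^ CARD('m) * (((8 * R\<^sup>2 + 16 / c'\<^sup>2) / R) ^ CARD('k) * (2 ^ k) ^ CARD('k))"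
    using 3 C \<delta> by (intro mult_left_mono) auto
  also have "\<dots> = M * \<delta> ^ CARD('m) * (2 ^ k) ^ CARD('k)"
    unfolding M_def by (simp only: power_mult_distrib mult_ac)
  finally show ?thesis by simp
qed

lemma emeasure_cube:
  fixes z :: "real ^ 'd::finite"
  assumes "r \<ge> 0"
  shows "emeasure lborel (cbox (\<chi> t. z $ t - r) (\<chi> t. z $ t + r)) = ennreal ((2 * r) ^ CARD('d))"
proof -
  have ne: "cbox (\<chi> t. z $ t - r) (\<chi> t. z $ t + r) \<noteq> {}"
    using assms by (auto simp: set_eq_iff mem_box_cart intro!: exI[of _ z])
  have "measure lborel (cbox (\<chi> t. z $ t - r) (\<chi> t. z $ t + r)) = (2 * r) ^ CARD('d)"
    unfolding content_cbox_cart[OF ne] by simp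
  then show ?thesis
    using emeasure_eq_ennreal_measure[of lborel "cbox (\<chi> t. z $ t - r) (\<chi> t. z $ t + r)"]
      emeasure_lborel_cbox_finite[of "\<chi> t. z $ t - r" "\<chi> t. z $ t + r"] by (simp add: less_top)
qed

text \<open>Enlarging \<open>\<psi>\<close> to the size at which \<open>dyadic_separation\<close> applies preserves convergence: the
  \<open>n\<close>-th power of a maximum is at most the sum of the \<open>n\<close>-th powers, the first part is Cauchy
  condensation and the second part is the series of \<open>(k+1)\<^sup>-\<^sup>\<beta>\<close>.\<close>
lemma dyadic_widths:
  fixes \<psi> :: "nat \<Rightarrow> real" and n :: nat
  assumes n: "n \<ge> 1" and beta: "\<beta> > 1"
    and pos: "\<And>q. q \<ge> 1 \<Longrightarrow> 0 \<le> \<psi> q" and anti: "antimono_on {1..} \<psi>" and summ: "summable (\<lambda>q. \<psi> q ^ n)"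
  defines "\<delta> \<equiv> \<lambda>k. max (\<psi> (2 ^ k)) (2 powr (- (real k / real n)) * (real k + 1) powr (- (\<beta> / real n)))"
  shows "summable (\<lambda>k. 2 ^ k * \<delta> k ^ n)"
proof -
  \<comment> \<open>The value at 0 may be negative, whereas the condensation test is about nonnegative terms.\<close>
  define f where "f q = (if q = 0 then 0 else \<psi> q ^ n)" for q :: nat
  have "summable f \<longleftrightarrow> summable (\<lambda>q. \<psi> q ^ n)"
    by (rule summable_cong) (auto simp: f_def eventually_at_top_linorder intro!: exI[of _ 1])
  then have "summable f" using summ by simp
  moreover have "summable f \<longleftrightarrow> summable (\<lambda>k. 2 ^ k * f (2 ^ k))"
  proof (rule condensation_test)
    fix q :: nat assume "0 < q"
    then have "\<psi> (Suc q) \<le> \<psi> q" using monotone_onD[OF anti, of q "Suc q"] by simp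
    then show "f (Suc q) \<le> f q" using \<open>0 < q\<close> pos by (auto simp: f_def intro!: power_mono)
  qed (use pos in \<open>auto simp: f_def\<close>)
  ultimately have s1: "summable (\<lambda>k. 2 ^ k * \<psi> (2 ^ k) ^ n)" by (simp add: f_def)
  have "summable (\<lambda>k. real k powr (- \<beta>))" using beta by (simp add: summable_real_powr_iff)
  then have "summable (\<lambda>k. real (Suc k) powr (- \<beta>))" by (subst summable_Suc_iff)
  then have s2: "summable (\<lambda>k. (real k + 1) powr (- \<beta>))" by (simp add: add.commute)
  show ?thesis
  proof (rule summable_comparison_test'[OF summable_add[OF s1 s2], of 0])
    fix k :: nat
    define e where "e = 2 powr (- (real k / real n)) * (real k + 1) powr (- (\<beta> / real n))"
    have e0: "e > 0" by (simp add: e_def)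
    have p0: "\<psi> (2 ^ k) \<ge> 0" using pos by simp
    have "e ^ n = e powr real n" using e0 by (simp add: powr_realpow)
    also have "\<dots> = 2 powr (- real k) * (real k + 1) powr (- \<beta>)"
      unfolding e_def using n by (simp add: powr_mult powr_powr)
    finally have en: "2 ^ k * e ^ n = (real k + 1) powr (- \<beta>)"
      by (simp add: powr_minus powr_realpow)
    have "\<delta> k ^ n \<le> \<psi> (2 ^ k) ^ n + e ^ n"
      unfolding \<delta>_def e_def[symmetric] using e0 p0 by (auto simp: max_def)
    then have "2 ^ k * \<delta> k ^ n \<le> 2 ^ k * (\<psi> (2 ^ k) ^ n + e ^ n)" by (intro mult_left_mono) auto
    moreover have "\<delta> k \<ge> 0" unfolding \<delta>_def using p0 by (simp add: max_def)
    ultimately show "norm (2 ^ k * \<delta> k ^ n) \<le> 2 ^ k * \<psi> (2 ^ k) ^ n + (real k + 1) powr (- \<beta>)"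
      using en by (simp add: distrib_left)
  qed
qed

text \<open>For \<open>q\<close> in the dyadic block of \<open>2\<^sup>k\<close> and \<open>|x| \<le> \<rho>\<close>, an approximation \<open>(a, b) / q\<close> of \<open>\<Phi> x\<close> places
  \<open>x\<close> in the cube of radius \<open>\<delta> k / 2\<^sup>k\<close> around \<open>a / q\<close>, and \<open>u = (q, a)\<close> satisfies
  \<open>u A = q (1,x) A - (0, q x - a) A\<close>, which is near the integer vector \<open>b\<close>. So \<open>x\<close> lies in \<open>Z \<rho> k\<close>,
  the union of these cubes, and \<open>dyadic_count\<close> bounds their number by a multiple of
  \<open>\<delta>\<^sup>m 2\<^sup>k\<^sup>(\<^sup>d\<^sup>+\<^sup>1\<^sup>)\<close>.\<close>
lemma khintchine_if_log_exponent_small: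
  fixes A :: "real ^ 'm::finite ^ ('d::finite option)"
  defines "n \<equiv> CARD('d) + CARD('m)"
  assumes om: "dioph_exponent A = ereal (real n)" and lom: "log_dioph_exponent A < - 1"
  shows "khintchine_type_convergence TYPE('d) (affine_subspace A)"
proof -
  have n1: "n \<ge> 1" unfolding n_def using zero_less_card_finite[where 'a = 'd] by linarith
  obtain \<beta> c where beta: "\<beta> > 1" and c: "c > 0" 
    and low: "\<And>j :: int ^ 'm. j \<noteq> 0 \<Longrightarrow> c * (infnorm (real_vec j) powr (- real n) * logm (infnorm (real_vec j)) powr \<beta>) \<le> dist_int (A *v real_vec j)"
    using dist_int_lower_bound[OF om lom] by blast
  obtain c' where c': "0 < c'" "c' \<le> 1"
    and sep: "\<And>k :: nat. \<And>j :: int ^ 'm. j \<noteq> 0 \<Longrightarrow> infnorm (real_vec j) \<le> 2 powr (real k / real n) * (real k + 1) powr (\<beta> / real n)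
      \<Longrightarrow> c' / 2 ^ k \<le> dist_int (A *v real_vec j)"
    using dyadic_separation[OF n1 beta c low] by blast
  define C where "C = 1 + (\<Sum>i\<in>UNIV. \<Sum>l\<in>UNIV. \<bar>A $ i $ l\<bar>)"
  have C: "C \<ge> 1" unfolding C_def by (auto intro!: sum_nonneg)
  have main: "simul_approx \<psi> \<inter> affine_subspace A \<in> null_sets (induced_lebesgue TYPE('d) (affine_subspace A))"
    if pos: "\<And>q. q \<ge> 1 \<Longrightarrow> 0 \<le> \<psi> q" and anti: "antimono_on {1..} \<psi>" and summ: "summable (\<lambda>q. \<psi> q ^ n)" for \<psi> :: "nat \<Rightarrow> real"
  proof -
    \<comment> \<open>The lower bound for \<open>\<delta> k\<close> is the smallest width for which all \<open>j\<close> up to \<open>1 / \<delta> k\<close> are in the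
      range of the separation property.\<close>
    define \<delta> where "\<delta> k = max (\<psi> (2 ^ k)) (2 powr (- (real k / real n)) * (real k + 1) powr (- (\<beta> / real n)))" for k
    have sd: "summable (\<lambda>k. 2 ^ k * \<delta> k ^ n)"
      unfolding \<delta>_def by (rule dyadic_widths[OF n1 beta pos anti summ])
    have d0: "\<delta> k > 0" for k unfolding \<delta>_def by (simp add: less_max_iff_disj)
    have dinv: "1 / \<delta> k \<le> 2 powr (real k / real n) * (real k + 1) powr (\<beta> / real n)" for k
    proof -
      define e where "e = 2 powr (- (real k / real n)) * (real k + 1) powr (- (\<beta> / real n))"
      have "1 / \<delta> k \<le> 1 / e" unfolding \<delta>_def e_def[symmetric] by (intro divide_left_mono) (auto simp: e_def less_max_iff_disj)
      then show ?thesis by (simp add: e_def powr_minus field_simps)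
    qed
    have small: "eventually (\<lambda>k. 6 * C * \<delta> k \<le> 1) sequentially"
    proof -
      have "(\<lambda>k. 2 ^ k * \<delta> k ^ n) \<longlonglongrightarrow> 0" using sd by (rule summable_LIMSEQ_zero)
      then have "eventually (\<lambda>k. 2 ^ k * \<delta> k ^ n < (1 / (6 * C)) ^ n) sequentially"
        using C by (intro order_tendstoD(2)) auto
      then show ?thesis
      proof eventually_elim
        case (elim k)
        have "1 * \<delta> k ^ n \<le> 2 ^ k * \<delta> k ^ n" using d0[of k] by (intro mult_right_mono) auto
        then have "\<delta> k ^ n < (1 / (6 * C)) ^ n" using elim by linarith
        then have "\<delta> k < 1 / (6 * C)" by (rule power_less_imp_less_base) (use C in auto)
        then show ?case using C by (simp add: field_simps)
      qed
    qed
    \<comment> \<open>The numerator satisfies \<open>|a t| \<le> q \<rho> + 1 \<le> q (\<rho> + 1)\<close> and the denominator \<open>q < 2 * 2 ^ k\<close>, whence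
      the radius of the box.\<close>
    define U where "U \<rho> k = {u :: 'd option \<Rightarrow> int. 2 ^ k \<le> u None \<and> (\<forall>i. \<bar>real_of_int (u i)\<bar> \<le> real (2 * (\<rho> + 1)) * 2 ^ k)
        \<and> (\<forall>l. \<exists>p. \<bar>(\<Sum>i\<in>UNIV. real_of_int (u i) * A $ i $ l) - real_of_int p\<bar> \<le> C * \<delta> k)}" for \<rho> k :: nat
    define ctr where "ctr u = (\<chi> t. real_of_int (u (Some t)) / real_of_int (u None))" for u :: "'d option \<Rightarrow> int"
    define Z where "Z \<rho> k = (\<Union>u\<in>U \<rho> k. cbox (\<chi> t. ctr u $ t - \<delta> k / 2 ^ k) (\<chi> t. ctr u $ t + \<delta> k / 2 ^ k))" for \<rho> k
    have finU: "finite (U \<rho> k)" for \<rho> k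
    proof (rule finite_subset)
      define N where "N = int (2 * (\<rho> + 1) * 2 ^ k)"
      show "U \<rho> k \<subseteq> {u. \<forall>i. u i \<in> {- N..N}}"
      proof
        fix u assume "u \<in> U \<rho> k"
        then have *: "\<bar>real_of_int (u i)\<bar> \<le> real_of_int N" for i by (simp add: U_def N_def algebra_simps)
        have "- N \<le> u i \<and> u i \<le> N" for i using *[of i] by linarith
        then show "u \<in> {u. \<forall>i. u i \<in> {- N..N}}" by simp
      qed
      show "finite {u :: 'd option \<Rightarrow> int. \<forall>i. u i \<in> {- N..N}}" by (rule finite_bounded_functions) simp
    qed
    have Zborel: "Z \<rho> k \<in> sets lborel" for \<rho> k unfolding Z_def using finU by (intro sets.finite_UN) auto
    have Zem: "emeasure lborel (Z \<rho> k) \<le> ennreal (real (card (U \<rho> k)) * (2 * (\<delta> k / 2 ^ k)) ^ CARD('d))" for \<rho> k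
    proof -
      have "emeasure lborel (Z \<rho> k) \<le> (\<Sum>u\<in>U \<rho> k. emeasure lborel (cbox (\<chi> t. ctr u $ t - \<delta> k / 2 ^ k) (\<chi> t. ctr u $ t + \<delta> k / 2 ^ k)))"
        unfolding Z_def using finU by (intro emeasure_subadditive_finite) auto
      also have "\<dots> = (\<Sum>u\<in>U \<rho> k. ennreal ((2 * (\<delta> k / 2 ^ k)) ^ CARD('d)))"
        using d0[of k] by (intro sum.cong refl emeasure_cube) simp
      also have "\<dots> = ennreal (real (card (U \<rho> k)) * (2 * (\<delta> k / 2 ^ k)) ^ CARD('d))"
        using d0[of k] by (simp add: ennreal_mult ennreal_of_nat_eq_real_of_nat)
      finally show ?thesis .
    qed
    have null: "limsup (Z \<rho>) \<in> null_sets lborel" for \<rho>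
    proof (rule borel_cantelli_limsup1)
      show "Z \<rho> k \<in> sets lborel" for k by (rule Zborel)
      show "emeasure lborel (Z \<rho> k) < \<infinity>" for k using Zem[of \<rho> k] by (rule le_less_trans) simp
      define R where "R = real (2 * (\<rho> + 1))"
      define M where "M = 4 ^ CARD('m) * (12 * C) ^ CARD('m) * ((8 * R\<^sup>2 + 16 / c'\<^sup>2) / R) ^ CARD('d option)"
      have R: "R \<ge> 1" "R \<in> \<nat>" unfolding R_def by auto
      show "summable (\<lambda>k. measure lborel (Z \<rho> k))"
      proof (rule summable_comparison_test_ev)
        show "summable (\<lambda>k. M * 2 ^ CARD('d) * (2 ^ k * \<delta> k ^ n))" using sd by (rule summable_mult)
        show "eventually (\<lambda>k. norm (measure lborel (Z \<rho> k)) \<le> M * 2 ^ CARD('d) * (2 ^ k * \<delta> k ^ n)) sequentially"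
          using small
        proof eventually_elim
          case (elim k)
          have cU: "real (card (U \<rho> k)) \<le> M * \<delta> k ^ CARD('m) * (2 ^ k) ^ CARD('d option)"
            unfolding M_def
          proof (rule dyadic_count[OF c' C R(1) _ d0 elim R(2)])
            fix j :: "int ^ 'm" assume "j \<noteq> 0" "infnorm (real_vec j) \<le> 1 / \<delta> k"
            then show "c' / 2 ^ k \<le> dist_int (A *v real_vec j)" using sep[of j k] dinv[of k] by linarith
          qed (auto simp: U_def R_def)
          have "measure lborel (Z \<rho> k) \<le> real (card (U \<rho> k)) * (2 * (\<delta> k / 2 ^ k)) ^ CARD('d)"
            using Zem[of \<rho> k] d0[of k] by (simp add: measure_def enn2real_leI)
          also have "\<dots> \<le> (M * \<delta> k ^ CARD('m) * (2 ^ k) ^ CARD('d option)) * (2 * (\<delta> k / 2 ^ k)) ^ CARD('d)"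
            using cU d0[of k] by (intro mult_right_mono) auto
          also have "\<dots> = M * 2 ^ CARD('d) * (2 ^ k * \<delta> k ^ n)"
            by (simp add: n_def power_add power_mult_distrib power_divide card_UNIV_option)
          finally show ?case by simp
        qed
      qed
    qed
    have cover: "x \<in> limsup (Z \<rho>)" if x: "subspace_point A x \<in> simul_approx \<psi>" and \<rho>: "\<And>t. \<bar>x $ t\<bar> \<le> real \<rho>" for x \<rho>
    proof -
      have "\<exists>k\<ge>k0. x \<in> Z \<rho> k" if k0: "6 * C * \<delta> k0 \<le> 1 \<and> (\<forall>k\<ge>k0. 6 * C * \<delta> k \<le> 1)" for k0
      proof -
        have "infinite {q :: nat. q \<ge> 1 \<and> dist_int (real q *\<^sub>R subspace_point A x) < \<psi> q}"
          using x by (simp add: simul_approx_def)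
        then obtain q where q: "q > 2 ^ k0" "dist_int (real q *\<^sub>R subspace_point A x) < \<psi> q"
          unfolding infinite_nat_iff_unbounded by auto
        define k where "k = floor_log q"
        have q0: "q > 0" using q(1) by (metis gr_zeroI not_less_zero)
        have kq: "2 ^ k \<le> q" "q < 2 * 2 ^ k"
          using floor_log_exp2_le[OF q0] floor_log_exp2_gt[of q] unfolding k_def by auto
        have "real (2 ^ k) \<le> real q" "real q < real (2 * 2 ^ k)" using kq by (simp_all only: of_nat_le_iff of_nat_less_iff)
        then have rq: "2 ^ k \<le> real q" "real q \<le> 2 * 2 ^ k" by simp_all
        have kk0: "k \<ge> k0" unfolding k_def using floor_log_mono[THEN monoD, of "2 ^ k0" q] q(1) by simp
        have "\<psi> q \<le> \<psi> (2 ^ k)" using monotone_onD[OF anti, of "2 ^ k" q] kq(1) q0 by simp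
        then have "dist_int (real q *\<^sub>R subspace_point A x) < \<delta> k" using q(2) by (simp add: \<delta>_def less_max_iff_disj)
        then obtain p where p: "\<And>i. \<bar>real q * subspace_point A x $ i - real_of_int (p i)\<bar> < \<delta> k"
          unfolding dist_int_less_iff by auto
        have d1: "\<delta> k \<le> 1"
        proof -
          have "1 * \<delta> k \<le> 6 * C * \<delta> k" using C d0[of k] by (intro mult_right_mono) auto
          then show ?thesis using k0 kk0 by fastforce
        qed
        define u where "u i = (case i of None \<Rightarrow> int q | Some t \<Rightarrow> p (Inl t))" for i :: "'d option"
        have px: "\<bar>real q * x $ t - real_of_int (p (Inl t))\<bar> < \<delta> k" for t
          using p[of "Inl t"] by (simp add: subspace_point_nth)
        have "u \<in> U \<rho> k"
          unfolding U_def mem_Collect_eq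
        proof (intro conjI allI)
          show "2 ^ k \<le> u None" using kq(1) by (simp add: u_def)
          fix i
          show "\<bar>real_of_int (u i)\<bar> \<le> real (2 * (\<rho> + 1)) * 2 ^ k"
          proof (cases i)
            case None
            have "real q \<le> 2 * 2 ^ k" by (rule rq(2))
            also have "\<dots> \<le> real (2 * (\<rho> + 1)) * 2 ^ k" by (intro mult_right_mono) auto
            finally show ?thesis using None by (simp add: u_def)
          next
            case (Some t)
            have "\<bar>real q * x $ t\<bar> \<le> real q * real \<rho>" unfolding abs_mult using \<rho> by (intro mult_mono) auto
            then have "\<bar>real_of_int (p (Inl t))\<bar> \<le> real q * real \<rho> + 1" using px[of t] d1 by linarith
            also have "\<dots> \<le> real q * real \<rho> + real q" using q0 by simp
            also have "\<dots> = real q * (real \<rho> + 1)" by (simp add: algebra_simps)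
            also have "\<dots> \<le> (2 * 2 ^ k) * (real \<rho> + 1)" using rq(2) by (intro mult_right_mono) auto
            finally show ?thesis using Some by (simp add: u_def algebra_simps)
          qed
        next
          fix l
          have "(\<Sum>i\<in>UNIV. real_of_int (u i) * A $ i $ l) = real q * subspace_point A x $ Inr l - (\<Sum>t\<in>UNIV. (real q * x $ t - real_of_int (p (Inl t))) * A $ Some t $ l)"
            by (simp add: subspace_point_nth u_def UNIV_option_conv sum.reindex algebra_simps sum_subtractf sum_distrib_left)
          then have "\<bar>(\<Sum>i\<in>UNIV. real_of_int (u i) * A $ i $ l) - real_of_int (p (Inr l))\<bar>
            \<le> \<bar>real q * subspace_point A x $ Inr l - real_of_int (p (Inr l))\<bar> + \<bar>\<Sum>t\<in>UNIV. (real q * x $ t - real_of_int (p (Inl t))) * A $ Some t $ l\<bar>"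
            by linarith
          also have "\<dots> \<le> \<delta> k + (\<Sum>t\<in>UNIV. \<delta> k * \<bar>A $ Some t $ l\<bar>)"
            by (intro add_mono order_trans[OF sum_abs] sum_mono less_imp_le[OF p], unfold abs_mult)
              (intro mult_right_mono less_imp_le[OF px], simp)
          also have "(\<Sum>t\<in>UNIV. \<delta> k * \<bar>A $ Some t $ l\<bar>) = \<delta> k * (\<Sum>t\<in>UNIV. \<bar>A $ Some t $ l\<bar>)" by (rule sum_distrib_left[symmetric])
          also have "\<delta> k + \<delta> k * (\<Sum>t\<in>UNIV. \<bar>A $ Some t $ l\<bar>) \<le> C * \<delta> k"
          proof -
            have "(\<Sum>t\<in>UNIV. \<bar>A $ Some t $ l\<bar>) \<le> (\<Sum>i\<in>UNIV. \<bar>A $ i $ l\<bar>)"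
              by (simp add: UNIV_option_conv sum.reindex)
            also have "\<dots> \<le> (\<Sum>i\<in>UNIV. \<Sum>l\<in>UNIV. \<bar>A $ i $ l\<bar>)"
              by (intro sum_mono member_le_sum) auto
            finally have "1 + (\<Sum>t\<in>UNIV. \<bar>A $ Some t $ l\<bar>) \<le> C" by (simp add: C_def)
            then have "(1 + (\<Sum>t\<in>UNIV. \<bar>A $ Some t $ l\<bar>)) * \<delta> k \<le> C * \<delta> k" using d0[of k] by (intro mult_right_mono) auto
            then show ?thesis by (simp add: algebra_simps)
          qed
          finally show "\<exists>p. \<bar>(\<Sum>i\<in>UNIV. real_of_int (u i) * A $ i $ l) - real_of_int p\<bar> \<le> C * \<delta> k" by blast
        qed
        moreover have "x \<in> cbox (\<chi> t. ctr u $ t - \<delta> k / 2 ^ k) (\<chi> t. ctr u $ t + \<delta> k / 2 ^ k)"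
        proof -
          have "\<bar>x $ t - ctr u $ t\<bar> \<le> \<delta> k / 2 ^ k" for t
          proof -
            have "x $ t - ctr u $ t = (real q * x $ t - real_of_int (p (Inl t))) / real q"
              using q0 by (simp add: ctr_def u_def field_simps)
            then have "\<bar>x $ t - ctr u $ t\<bar> = \<bar>real q * x $ t - real_of_int (p (Inl t))\<bar> / real q"
              by (simp add: abs_divide)
            also have "\<dots> \<le> \<delta> k / 2 ^ k"
            proof (rule frac_le)
              show "(2::real) ^ k \<le> real q" by (rule rq(1))
            qed (use px[of t] d0[of k] in auto)
            finally show ?thesis .
          qed
          then have "ctr u $ t - \<delta> k / 2 ^ k \<le> x $ t \<and> x $ t \<le> ctr u $ t + \<delta> k / 2 ^ k" for t
            by (simp add: abs_diff_le_iff)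
          then show ?thesis by (simp add: mem_box_cart)
        qed
        ultimately show ?thesis using kk0 unfolding Z_def by blast
      qed
      note ex = this
      obtain k1 where k1: "\<And>k. k \<ge> k1 \<Longrightarrow> 6 * C * \<delta> k \<le> 1" using small unfolding eventually_sequentially by blast
      have "\<exists>m\<ge>k. x \<in> Z \<rho> m" for k
      proof -
        have "6 * C * \<delta> (max k k1) \<le> 1 \<and> (\<forall>l\<ge>max k k1. 6 * C * \<delta> l \<le> 1)" using k1 by simp
        from ex[OF this] show ?thesis by (auto intro: order_trans)
      qed
      then show ?thesis unfolding limsup_INF_SUP by auto
    qed
    show ?thesis
    proof (rule affine_subspace_null)
      show "(\<Union>\<rho>. limsup (Z \<rho>)) \<in> null_sets lborel" using null by (rule null_sets_UN)
      fix x assume "append_vec x (tilde_vec x v* A) \<in> simul_approx \<psi> \<inter> affine_subspace A"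
      then have x: "subspace_point A x \<in> simul_approx \<psi>" by (simp add: subspace_point_def)
      obtain \<rho> :: nat where "infnorm x \<le> real \<rho>" using real_arch_simple by blast
      then have "x \<in> limsup (Z \<rho>)" by (intro cover x) (simp add: infnorm_le_iff)
      then show "x \<in> (\<Union>\<rho>. limsup (Z \<rho>))" by blast
    qed auto
  qed
  have "CARD('d + 'm) = n" by (simp add: n_def)
  show ?thesis unfolding khintchine_type_convergence_def \<open>CARD('d + 'm) = n\<close> using main by blast
qed


section \<open>Both halves together\<close>

theorem theorem2p2:
  fixes A :: "real ^ 'm::finite ^ ('d::finite option)"
  assumes "dioph_exponent A = ereal (real (CARD('d) + CARD('m)))"
  shows "(log_dioph_exponent A < - 1 \<longrightarrow>
            khintchine_type_convergence TYPE('d) (affine_subspace A)) \<and>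
         (log_dioph_exponent A > ereal (real (CARD('d) + CARD('m))) \<longrightarrow>
            \<not> khintchine_type_convergence TYPE('d) (affine_subspace A))"
  using khintchine_if_log_exponent_small[of A] not_khintchine_if_log_exponent_large[of A] assms
  by blast

end
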